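(* Let $P_0,P_X$ be probability measures on $\mathbb R$ supported in $[-C,C]$ for some finite $C$, and let $(g,g^0)$ satisfy the regularity and consistency hypotheses stated in the context. Let $\bar\beta=(\beta,\beta_{SNR},\beta_S)$ be given by $$\beta=\Big(\mathbb E_{P_{\rm out}(Y|0)}\big[(\partial_wg(Y,0))^2\big]\Big)^{1/2},\quad \beta_{SNR}=\mathbb E_{P_{\rm out}(Y|0)}\big[\partial_wg(Y,0)\,\partial_wg^0(Y,0)\big],\quad \beta_S=\mathbb E_{P_{\rm out}(Y|0)}\big[\partial_w^2g(Y,0)\big].$$ Then, for $N$ large enough, $|F_N(g)-F_N(\bar\beta)|=O(N^{-1/2})$. More generally, for any sequence of measurable sets $A=A_N(x^0)\subset\mathbb R^N$ (possibly depending on $x^0$ but not on the remaining randomness) such that $\liminf_{N\to\infty}F_N(0:A)>-\infty$, $$|F_N(g:A)-F_N(\bar\beta:A)|=O(N^{-1/2}).$$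
   Context: Inference model. $g,g^0:\mathbb R\times\mathbb R\to\mathbb R$ are functions of $(Y,w)$; $P_{\rm out}(dY|w)=e^{g^0(Y,w)}dY$ is a probability measure for each $w$. The signal $x^0=(x^0_i)$ is i.i.d. with law $P_0$; given $x^0$, the observations $Y_{ij}$ ($1\le i<j\le N$) are independent with $Y_{ij}\sim P_{\rm out}(\cdot\,|\,x_i^0x_j^0/\sqrt N)$. $$F_N(g:A)=\frac1N\mathbb E_{Y}\Big[\log\int\mathbf 1(x\in A)e^{\sum_{i<j}g(Y_{ij},x_ix_j/\sqrt N)}dP_X^{\otimes N}(x)-\sum_{i<j}g(Y_{ij},0)\Big],\qquad F_N(g)=F_N(g:\mathbb R^N),$$ where $\mathbb E_Y$ is the expectation over $(Y,x^0)$. Gaussian model. With $W_{ij}$ ($i<j$) i.i.d. standard Gaussians independent of $x^0$, $$H_N^{\bar\beta}(x)=\sum_{i<j}\Big(\frac{\beta W_{ij}}{\sqrt N}x_ix_j+\frac{\beta_{SNR}}{N}x_ix_jx_i^0x_j^0+\frac{\beta_S}{2N}(x_ix_j)^2\Big),\quad F_N(\bar\beta:A)=\frac1N\mathbb E_{W,x^0}\log\int\mathbf 1(x\in A)e^{H_N^{\bar\beta}(x)}dP_X^{\otimes N}(x),$$ $F_N(\bar\beta)=F_N(\bar\beta:\mathbb R^N)$, and $F_N(0:A)=\frac1N\mathbb E_{x^0}\log P_X^{\otimes N}(A)$. Regularity hypothesis: $g$ is three times and $g^0$ twice differentiable in $w$, and, with $\|\cdot\|$ the supremum norm, the quantities $\mathbb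 E_{P_{\rm out}(Y|0)}[(\partial_wg(Y,0))^3]$, $\|\partial_w^2g(\cdot,0)\|$, $\|\partial_w^3g\|$ (supremum over $(Y,w)$) and $\|\partial_wg(\cdot,0)\|$ are bounded. Consistency hypothesis: $\mathbb E_{P_{\rm out}(Y|0)}[\partial_wg(Y,0)]=\int\partial_wg(y,0)e^{g^0(y,0)}dy=0$.
   Formalization: Added hypothesis: for w near 0, |∂_w² e^{g⁰(Y,w)}| is dominated by an integrable function of Y. Without such control of g⁰ in w the claim fails: a heavy-tailed channel with g=sgn(Y)w, P_0=P_X=δ_1 gives F_N(g) of order N^{1/4} while F_N(β̄)=0. *)

theory Defs
  imports "HOL-Probability.Probability"
begin

section \<open>Extended-valued logarithm and expectation\<close>

text \<open>
  The library's \<open>ln 0 = 0\<close> and the value \<open>0\<close> of the Bochner integral of a non-integrable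
  function would make the hypothesis \<open>liminf F\<^sub>N(0:A) > -\<infinity>\<close> void: a set \<open>A\<close> that is null with
  positive probability must have free energy \<open>-\<infinity>\<close>.  Free energies are therefore \<open>ereal\<close>-valued.
  In \<open>ereal\<close> one has \<open>\<infinity> - \<infinity> = -\<infinity> - (-\<infinity>) = \<infinity>\<close>, so an undefined expectation has the value \<open>\<infinity>\<close>,
  and a finite bound on \<open>\<bar>F - F'\<bar>\<close> forces both \<open>F\<close> and \<open>F'\<close> to be finite.
\<close>

definition elog :: "ennreal \<Rightarrow> ereal" where
  "elog z = (if z = 0 then -\<infinity> else if z = \<infinity> then \<infinity> else ereal (ln (enn2real z)))"

definition eexpectation :: "'a measure \<Rightarrow> ('a \<Rightarrow> ereal) \<Rightarrow> ereal" where
  "eexpectation M f =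
     enn2ereal (\<integral>\<^sup>+ x. e2ennreal (f x) \<partial>M) - enn2ereal (\<integral>\<^sup>+ x. e2ennreal (- f x) \<partial>M)"


section \<open>Configurations and observations\<close>

text \<open>Vectors of \<open>\<real>\<^sup>N\<close> are extensional functions on \<open>{..<N}\<close>; indices start at \<open>0\<close>.\<close>

definition pairs :: "nat \<Rightarrow> (nat \<times> nat) set" where
  "pairs N = {(i, j). i < j \<and> j < N}"

abbreviation conf_space :: "nat \<Rightarrow> (nat \<Rightarrow> real) measure" where
  "conf_space N \<equiv> PiM {..<N} (\<lambda>_. borel)"

abbreviation obs_space :: "nat \<Rightarrow> (nat \<times> nat \<Rightarrow> real) measure" where
  "obs_space N \<equiv> PiM (pairs N) (\<lambda>_. borel)"

text \<open>
  A sequence of measurable sets \<open>A\<^sub>N(x\<^sup>0) \<subseteq> \<real>\<^sup>N\<close>, measurable jointly in \<open>(x\<^sup>0, x)\<close>, which is what the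
  measurability in \<open>x\<^sup>0\<close> of the partition functions needs.  Each section \<open>A N x0\<close> is then a
  measurable subset of \<open>\<real>\<^sup>N\<close>.
\<close>

definition measurable_set_family :: "(nat \<Rightarrow> (nat \<Rightarrow> real) \<Rightarrow> (nat \<Rightarrow> real) set) \<Rightarrow> bool" where
  "measurable_set_family A \<longleftrightarrow>
     (\<forall>N. (SIGMA x0:space (conf_space N). A N x0) \<in> sets (conf_space N \<Otimes>\<^sub>M conf_space N))"

definition whole_space :: "nat \<Rightarrow> (nat \<Rightarrow> real) \<Rightarrow> (nat \<Rightarrow> real) set" where
  "whole_space N x0 = space (conf_space N)"


section \<open>The inference model\<close>

definition Pout :: "(real \<Rightarrow> real \<Rightarrow> real) \<Rightarrow> real \<Rightarrow> real measure" where
  "Pout g0 w = density lborel (\<lambda>y. ennreal (exp (g0 y w)))"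

definition obs_law :: "(real \<Rightarrow> real \<Rightarrow> real) \<Rightarrow> nat \<Rightarrow> (nat \<Rightarrow> real) \<Rightarrow> (nat \<times> nat \<Rightarrow> real) measure" where
  "obs_law g0 N x0 = PiM (pairs N) (\<lambda>(i, j). Pout g0 (x0 i * x0 j / sqrt (real N)))"

text \<open>The joint law of \<open>(x\<^sup>0, Y)\<close>.\<close>

definition inference_law ::
  "(real \<Rightarrow> real \<Rightarrow> real) \<Rightarrow> real measure \<Rightarrow> nat \<Rightarrow> ((nat \<Rightarrow> real) \<times> (nat \<times> nat \<Rightarrow> real)) measure" where
  "inference_law g0 P0 N = do {
     x0 \<leftarrow> PiM {..<N} (\<lambda>_. P0);
     Y \<leftarrow> obs_law g0 N x0;
     return (conf_space N \<Otimes>\<^sub>M obs_space N) (x0, Y)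
   }"

definition F_inf ::
  "(real \<Rightarrow> real \<Rightarrow> real) \<Rightarrow> (real \<Rightarrow> real \<Rightarrow> real) \<Rightarrow> real measure \<Rightarrow> real measure \<Rightarrow>
   (nat \<Rightarrow> (nat \<Rightarrow> real) \<Rightarrow> (nat \<Rightarrow> real) set) \<Rightarrow> nat \<Rightarrow> ereal" where
  "F_inf g g0 P0 PX A N = ereal (1 / real N) *
     eexpectation (inference_law g0 P0 N) (\<lambda>(x0, Y).
       elog (\<integral>\<^sup>+ x. indicator (A N x0) x *
               ennreal (exp (\<Sum>(i, j)\<in>pairs N. g (Y (i, j)) (x i * x j / sqrt (real N))))
             \<partial>PiM {..<N} (\<lambda>_. PX))
       - ereal (\<Sum>(i, j)\<in>pairs N. g (Y (i, j)) 0))"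


section \<open>The Gaussian model\<close>

definition gauss_hamiltonian ::
  "real \<Rightarrow> real \<Rightarrow> real \<Rightarrow> nat \<Rightarrow> (nat \<Rightarrow> real) \<Rightarrow> (nat \<times> nat \<Rightarrow> real) \<Rightarrow> (nat \<Rightarrow> real) \<Rightarrow> real" where
  "gauss_hamiltonian \<beta> \<beta>_SNR \<beta>_S N x0 W x =
     (\<Sum>(i, j)\<in>pairs N.
        \<beta> * W (i, j) / sqrt (real N) * x i * x j
        + \<beta>_SNR / real N * x i * x j * x0 i * x0 j
        + \<beta>_S / (2 * real N) * (x i * x j)\<^sup>2)"

definition F_gauss ::
  "real \<Rightarrow> real \<Rightarrow> real \<Rightarrow> real measure \<Rightarrow> real measure \<Rightarrow>
   (nat \<Rightarrow> (nat \<Rightarrow> real) \<Rightarrow> (nat \<Rightarrow> real) set) \<Rightarrow> nat \<Rightarrow> ereal" where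
  "F_gauss \<beta> \<beta>_SNR \<beta>_S P0 PX A N = ereal (1 / real N) *
     eexpectation (PiM {..<N} (\<lambda>_. P0) \<Otimes>\<^sub>M PiM (pairs N) (\<lambda>_. std_normal_distribution)) (\<lambda>(x0, W).
       elog (\<integral>\<^sup>+ x. indicator (A N x0) x * ennreal (exp (gauss_hamiltonian \<beta> \<beta>_SNR \<beta>_S N x0 W x))
             \<partial>PiM {..<N} (\<lambda>_. PX)))"

definition F_zero ::
  "real measure \<Rightarrow> real measure \<Rightarrow> (nat \<Rightarrow> (nat \<Rightarrow> real) \<Rightarrow> (nat \<Rightarrow> real) set) \<Rightarrow> nat \<Rightarrow> ereal" where
  "F_zero P0 PX A N = ereal (1 / real N) *
     eexpectation (PiM {..<N} (\<lambda>_. P0)) (\<lambda>x0. elog (emeasure (PiM {..<N} (\<lambda>_. PX)) (A N x0)))"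


section \<open>Hypotheses on the channel\<close>

text \<open>The \<open>k\<close>-th partial derivative \<open>\<partial>\<^sub>w\<^sup>k g(y, w)\<close>.\<close>

definition dw :: "nat \<Rightarrow> (real \<Rightarrow> real \<Rightarrow> real) \<Rightarrow> real \<Rightarrow> real \<Rightarrow> real" where
  "dw k g y w = (deriv ^^ k) (g y) w"

definition times_differentiable_w :: "nat \<Rightarrow> (real \<Rightarrow> real \<Rightarrow> real) \<Rightarrow> bool" where
  "times_differentiable_w n g \<longleftrightarrow> (\<forall>y w. \<forall>k<n. dw k g y differentiable (at w))"

definition regularity_hyp :: "(real \<Rightarrow> real \<Rightarrow> real) \<Rightarrow> (real \<Rightarrow> real \<Rightarrow> real) \<Rightarrow> bool" where
  "regularity_hyp g g0 \<longleftrightarrow>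
     times_differentiable_w 3 g \<and> times_differentiable_w 2 g0 \<and>
     integrable (Pout g0 0) (\<lambda>y. (dw 1 g y 0) ^ 3) \<and>
     bounded (range (\<lambda>y. dw 2 g y 0)) \<and>
     bounded (range (\<lambda>(y, w). dw 3 g y w)) \<and>
     bounded (range (\<lambda>y. dw 1 g y 0))"

definition consistency_hyp :: "(real \<Rightarrow> real \<Rightarrow> real) \<Rightarrow> (real \<Rightarrow> real \<Rightarrow> real) \<Rightarrow> bool" where
  "consistency_hyp g g0 \<longleftrightarrow> integral\<^sup>L (Pout g0 0) (\<lambda>y. dw 1 g y 0) = 0"

text \<open>
  The regularity in \<open>w\<close> of the channel itself: near \<open>w = 0\<close> the second derivative of the density
  \<open>e\<^bsup>g0(y,w)\<^esup>\<close> is dominated by an integrable function of \<open>y\<close>, so that \<open>P\<^sub>o\<^sub>u\<^sub>t(dY|w)\<close> may be expanded to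
  second order under the integral.  Pointwise differentiability of \<open>g0\<close> alone does not suffice:
  let \<open>q(y) = (1 + \<bar>y\<bar>)\<^bsup>-3/2\<^esup> / 4\<close>, let \<open>\<chi>\<close> be smooth, \<open>0\<close> on \<open>[0,1]\<close>, \<open>1\<close> on \<open>[2,\<infinity>)\<close>, with values
  in \<open>[0,1]\<close>, and take \<open>e\<^bsup>g0(y,w)\<^esup> = q(y) (1 + sgn(y) \<chi>(\<bar>y w\<bar>) / 2)\<close>, \<open>g(y,w) = sgn(y) w\<close>.  Then
  \<open>\<beta>\<^sub>S\<^sub>N\<^sub>R = \<beta>\<^sub>S = 0\<close>, but the mean of \<open>\<partial>\<^sub>w g(Y,0)\<close> under \<open>P\<^sub>o\<^sub>u\<^sub>t(\<cdot>|w)\<close> is of order \<open>\<bar>w\<bar>\<^bsup>1/2\<^esup>\<close>, and for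
  \<open>P\<^sub>0 = P\<^sub>X = \<delta>\<^sub>1\<close> the free energy of the inference model grows like \<open>N\<^bsup>1/4\<^esup>\<close> while the Gaussian
  one is \<open>0\<close>.
  A bound on \<open>\<partial>\<^sub>w\<^sup>2 g0\<close>, uniform in \<open>y\<close> and in \<open>w\<close> near \<open>0\<close>, implies the condition below.
\<close>

definition channel_dominated :: "(real \<Rightarrow> real \<Rightarrow> real) \<Rightarrow> bool" where
  "channel_dominated g0 \<longleftrightarrow>
     (\<exists>\<delta>>0. \<exists>D. integrable lborel D \<and>
        (\<forall>y w. \<bar>w\<bar> \<le> \<delta> \<longrightarrow> \<bar>dw 2 (\<lambda>y w. exp (g0 y w)) y w\<bar> \<le> D y))"


section \<open>The joint law is well defined\<close>

text \<open>
  \<open>bind\<close> is only meaningful for measurable kernels; the following facts show that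
  \<open>inference_law\<close> is the intended mixture.
\<close>

lemma finite_pairs [simp]: "finite (pairs N)"
  by (rule finite_subset[of _ "{..<N} \<times> {..<N}"]) (auto simp: pairs_def)

lemma sets_Pout [measurable_cong, simp]: "sets (Pout g0 w) = sets borel"
  by (simp add: Pout_def)

lemma space_Pout [simp]: "space (Pout g0 w) = UNIV"
  by (simp add: Pout_def)

lemma sets_obs_law: "sets (obs_law g0 N x0) = sets (obs_space N)"
  unfolding obs_law_def by (rule sets_PiM_cong) (auto split: prod.splits)

lemma prob_space_obs_law:
  assumes "\<And>w. prob_space (Pout g0 w)"
  shows "prob_space (obs_law g0 N x0)"
  unfolding obs_law_def by (rule prob_space_PiM) (auto split: prod.splits intro: assms)

lemma emeasure_Pout_measurable:
  assumes g0: "case_prod g0 \<in> borel_measurable (borel \<Otimes>\<^sub>M borel)" and B: "B \<in> sets borel"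
  shows "(\<lambda>w. emeasure (Pout g0 w) B) \<in> borel_measurable borel"
proof -
  have [measurable]: "(\<lambda>p. g0 (snd p) (fst p)) \<in> borel_measurable (borel \<Otimes>\<^sub>M borel)"
    using measurable_compose[OF measurable_Pair[OF measurable_snd measurable_fst] g0] by simp
  have [measurable]: "(\<lambda>y. g0 y w) \<in> borel_measurable borel" for w
    using measurable_compose[OF measurable_Pair2' g0, of w] by simp
  have eq: "emeasure (Pout g0 w) B = (\<integral>\<^sup>+ y. ennreal (exp (g0 y w)) * indicator B y \<partial>lborel)" for w
    unfolding Pout_def using B by (subst emeasure_density) (simp_all, measurable)
  have "(\<lambda>p. ennreal (exp (g0 (snd p) (fst p))) * indicator B (snd p))
      \<in> borel_measurable (borel \<Otimes>\<^sub>M borel)"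
    using B by measurable
  then have "(\<lambda>(w, y). ennreal (exp (g0 y w)) * indicator B y) \<in> borel_measurable (borel \<Otimes>\<^sub>M lborel)"
    by (simp add: split_beta' measurable_cong_sets[OF sets_pair_measure_cong[OF refl sets_lborel] refl])
  then show ?thesis
    unfolding eq by (rule lborel.borel_measurable_nn_integral)
qed

lemma obs_law_measurable:
  assumes g0: "case_prod g0 \<in> borel_measurable (borel \<Otimes>\<^sub>M borel)"
    and prob: "\<And>w. prob_space (Pout g0 w)"
  shows "obs_law g0 N \<in> measurable (conf_space N) (prob_algebra (obs_space N))"
proof (rule measurable_prob_algebra_generated)
  show "sets (obs_space N) = sigma_sets (\<Pi>\<^sub>E p\<in>pairs N. space borel)
      (prod_algebra (pairs N) (\<lambda>_. borel))"
    by (rule sets_PiM)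
  show "Int_stable (prod_algebra (pairs N) (\<lambda>_. borel :: real measure))"
    by (rule Int_stable_prod_algebra)
  show "prod_algebra (pairs N) (\<lambda>_. borel :: real measure)
      \<subseteq> Pow (\<Pi>\<^sub>E p\<in>pairs N. space borel)"
    by (rule prod_algebra_sets_into_space)
next
  fix x0 assume "x0 \<in> space (conf_space N)"
  show "prob_space (obs_law g0 N x0)" by (rule prob_space_obs_law[OF prob])
  show "sets (obs_law g0 N x0) = sets (obs_space N)" by (rule sets_obs_law)
next
  fix A assume "A \<in> prod_algebra (pairs N) (\<lambda>_. borel :: real measure)"
  then obtain E where A: "A = Pi\<^sub>E (pairs N) E" and E: "\<And>p. p \<in> pairs N \<Longrightarrow> E p \<in> sets borel"
    by (elim prod_algebraE_all) auto
  have eq: "emeasure (obs_law g0 N x0) A =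
      (\<Prod>p\<in>pairs N. emeasure (Pout g0 (x0 (fst p) * x0 (snd p) / sqrt (real N))) (E p))" for x0
  proof -
    interpret product_prob_space "\<lambda>p. Pout g0 (x0 (fst p) * x0 (snd p) / sqrt (real N))" "pairs N"
      by (intro product_prob_spaceI prob)
    show ?thesis
      unfolding obs_law_def A split_beta' by (rule emeasure_PiM) (auto simp: E)
  qed
  show "(\<lambda>x0. emeasure (obs_law g0 N x0) A) \<in> borel_measurable (conf_space N)"
    unfolding eq
  proof (rule borel_measurable_prod_ennreal)
    fix p assume p: "p \<in> pairs N"
    then have mem: "fst p \<in> {..<N}" "snd p \<in> {..<N}" by (auto simp: pairs_def)
    have "(\<lambda>x0. x0 (fst p) * x0 (snd p) / sqrt (real N)) \<in> borel_measurable (conf_space N)"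
      by (intro borel_measurable_divide borel_measurable_times borel_measurable_const
          measurable_component_singleton mem)
    from measurable_compose[OF this emeasure_Pout_measurable[OF g0 E[OF p]]]
    show "(\<lambda>x0. emeasure (Pout g0 (x0 (fst p) * x0 (snd p) / sqrt (real N))) (E p))
        \<in> borel_measurable (conf_space N)" .
  qed
qed

lemma
  assumes g0: "case_prod g0 \<in> borel_measurable (borel \<Otimes>\<^sub>M borel)"
    and prob: "\<And>w. prob_space (Pout g0 w)"
    and P0: "prob_space P0" "sets P0 = sets borel"
  shows prob_space_inference_law: "prob_space (inference_law g0 P0 N)"
    and sets_inference_law: "sets (inference_law g0 P0 N) = sets (conf_space N \<Otimes>\<^sub>M obs_space N)"
    and nn_integral_inference_law: "f \<in> borel_measurable (conf_space N \<Otimes>\<^sub>M obs_space N) \<Longrightarrow>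
      (\<integral>\<^sup>+ z. f z \<partial>inference_law g0 P0 N) =
      (\<integral>\<^sup>+ x0. \<integral>\<^sup>+ Y. f (x0, Y) \<partial>obs_law g0 N x0 \<partial>PiM {..<N} (\<lambda>_. P0))"
proof -
  let ?M = "PiM {..<N} (\<lambda>_. P0)" and ?S = "conf_space N \<Otimes>\<^sub>M obs_space N"
  let ?K = "\<lambda>x0. obs_law g0 N x0 \<bind> (\<lambda>Y. return ?S (x0, Y))"
  interpret M: prob_space ?M by (rule prob_space_PiM) (rule P0)
  have sM [measurable_cong]: "sets ?M = sets (conf_space N)" by (rule sets_PiM_cong) (auto simp: P0)
  have O [measurable]: "obs_law g0 N \<in> measurable ?M (prob_algebra (obs_space N))"
    using obs_law_measurable[OF g0 prob] by (simp only: measurable_cong_sets[OF sM refl])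
  have K [measurable]: "?K \<in> measurable ?M (prob_algebra ?S)"
    by (rule measurable_bind_prob_space2[OF O]) measurable
  have Min: "?M \<in> space (prob_algebra ?M)" by (simp add: space_prob_algebra M.prob_space_axioms)
  have "inference_law g0 P0 N \<in> space (prob_algebra ?S)"
    unfolding inference_law_def by (rule measurable_bind_prob_space[OF _ K, THEN measurable_space, of "\<lambda>_. ?M" "count_space UNIV" undefined])
      (auto simp: Min)
  then show "prob_space (inference_law g0 P0 N)" "sets (inference_law g0 P0 N) = sets ?S"
    by (auto simp: space_prob_algebra)
  assume f: "f \<in> borel_measurable ?S"
  have "(\<integral>\<^sup>+ z. f z \<partial>inference_law g0 P0 N) = (\<integral>\<^sup>+ x0. \<integral>\<^sup>+ z. f z \<partial>?K x0 \<partial>?M)"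
    unfolding inference_law_def by (rule nn_integral_bind[OF f measurable_prob_algebraD[OF K]])
  also have "\<dots> = (\<integral>\<^sup>+ x0. \<integral>\<^sup>+ Y. f (x0, Y) \<partial>obs_law g0 N x0 \<partial>?M)"
  proof (rule nn_integral_cong)
    fix x0 assume "x0 \<in> space ?M"
    then have x0: "x0 \<in> space (conf_space N)" using sets_eq_imp_space_eq[OF sM] by simp
    have "(\<lambda>Y. return ?S (x0, Y)) \<in> measurable (obs_law g0 N x0) (subprob_algebra ?S)"
      using measurable_compose[OF measurable_Pair1'[OF x0] return_measurable]
      by (simp only: measurable_cong_sets[OF sets_obs_law refl])
    then have "(\<integral>\<^sup>+ z. f z \<partial>?K x0) = (\<integral>\<^sup>+ Y. \<integral>\<^sup>+ z. f z \<partial>return ?S (x0, Y) \<partial>obs_law g0 N x0)"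
      by (rule nn_integral_bind[OF f])
    also have "\<dots> = (\<integral>\<^sup>+ Y. f (x0, Y) \<partial>obs_law g0 N x0)"
      using x0 by (intro nn_integral_cong nn_integral_return f)
        (auto simp: space_pair_measure sets_eq_imp_space_eq[OF sets_obs_law])
    finally show "(\<integral>\<^sup>+ z. f z \<partial>?K x0) = (\<integral>\<^sup>+ Y. f (x0, Y) \<partial>obs_law g0 N x0)" .
  qed
  finally show "(\<integral>\<^sup>+ z. f z \<partial>inference_law g0 P0 N) =
      (\<integral>\<^sup>+ x0. \<integral>\<^sup>+ Y. f (x0, Y) \<partial>obs_law g0 N x0 \<partial>?M)" .
qed

end

theory Submission
  imports Defs
begin

text \<open>
  Lindeberg's replacement method, one pair at a time.  Conditionally on \<open>x\<^sup>0\<close> the observations are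
  independent.  Freezing all pairs but one, the log-partition function is, up to a constant, the
  log-moment generating function of the energy of that pair under a tilted prior.  This energy is
  \<open>O(N\<^sup>-\<^sup>1\<^sup>/\<^sup>2)\<close>; with \<open>a = x\<^sub>i x\<^sub>j / \<surd>N\<close> a second-order cumulant expansion shows that its mean over the
  observation depends, up to \<open>O(N\<^sup>-\<^sup>3\<^sup>/\<^sup>2)\<close>, only on the first two moments of \<open>\<partial>\<^sub>w g(Y,0)\<close> and on the mean
  of \<open>\<partial>\<^sub>w\<^sup>2 g(Y,0)\<close>, which the Gaussian model matches by the choice of \<open>\<beta>\<close>, \<open>\<beta>\<^sub>S\<^sub>N\<^sub>R\<close>, \<open>\<beta>\<^sub>S\<close>.
  Replacing fewer than \<open>N\<^sup>2\<close> pairs and dividing by \<open>N\<close> leaves an error \<open>O(N\<^sup>-\<^sup>1\<^sup>/\<^sup>2)\<close>, uniformly in the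
  prior and hence in \<open>A\<close>.  The hypothesis on \<open>F\<^sub>N(0:A)\<close> only serves to make both free energies finite.
\<close>

section \<open>Second-order expansion of the log-moment generating function\<close>

text \<open>The power counting is tight at first order. There are of order N^2 pairs and a prefactor
  1/N, so one pair may contribute an error of O(N^(-3/2)), whereas its leading term, the mean of
  \<open>dw 1 g y 0\<close> times the mean of a, has order N^(-1/2). The consistency hypothesis
  removes this mean at w = 0. The actual channel sits at w = x0_i x0_j / sqrt N and shifts the mean
  by \<beta>_SNR * w, which leaves a term of order 1/N to be matched. The terms with a^2 already
  have order 1/N, so their coefficients matter only at w = 0. Two obstacles shape the estimates.
  Gaussian noise is unbounded, so the cumulant expansion cannot assume a small exponent; its error
  must be a polynomial in the noise. The terms \<open>g y 0\<close> are removed pair by pair,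
  because only the increments of g in w are controlled.\<close>

text \<open>The Lagrange remainder is exp t * x^3 / 6 with t \<le> 1, and exp 1 \<le> 6 makes the
  constant 1 suffice.\<close>

lemma exp_cubic_remainder:
  fixes x :: real
  assumes "\<bar>x\<bar> \<le> b" "b \<le> 1"
  shows "\<bar>exp x - 1 - x - x\<^sup>2 / 2\<bar> \<le> b ^ 3"
proof -
  obtain t where t: "\<bar>t\<bar> \<le> \<bar>x\<bar>" "exp x = (\<Sum>m<3. x ^ m / fact m) + exp t / fact 3 * x ^ 3"
    using Maclaurin_exp_le[of x 3] by blast
  have "t \<le> 1" using t(1) assms by linarith
  then have "exp t \<le> exp 1" by simp
  also have "\<dots> \<le> 6" using exp_le by linarith
  finally have "exp t * \<bar>x\<bar> ^ 3 / 6 \<le> b ^ 3"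
    using mult_mono[OF _ power_mono[OF assms(1), of 3], of "exp t" 6] assms by simp
  moreover have "exp x - 1 - x - x\<^sup>2 / 2 = exp t * x ^ 3 / 6"
    using t(2) by (simp add: eval_nat_numeral fact_numeral)
  moreover have "\<bar>exp t * x ^ 3 / 6\<bar> = exp t * \<bar>x\<bar> ^ 3 / 6"
    by (simp add: abs_mult power_abs)
  ultimately show ?thesis by simp
qed

text \<open>The function inside the absolute value has derivative z^2 / (1 + z), at most 2 * s^2 for
  |z| \<le> |s| because 1 + z \<ge> 1/2; the mean value inequality supplies the third factor
  |s|.\<close>

lemma ln_cubic_remainder:
  fixes s :: real
  assumes "\<bar>s\<bar> \<le> 1 / 2"
  shows "\<bar>ln (1 + s) - s + s\<^sup>2 / 2\<bar> \<le> 2 * \<bar>s\<bar> ^ 3"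
proof -
  define f :: "real \<Rightarrow> real" where "f s = ln (1 + s) - s + s\<^sup>2 / 2" for s
  have "norm (f s - f 0) \<le> 2 * s\<^sup>2 * norm (s - 0)"
  proof (rule field_differentiable_bound[of "cball 0 \<bar>s\<bar>"])
    fix z :: real assume "z \<in> cball 0 \<bar>s\<bar>"
    then have z: "\<bar>z\<bar> \<le> \<bar>s\<bar>" by (simp add: dist_real_def)
    with assms have z1: "1 + z \<ge> 1 / 2" by linarith
    show "(f has_field_derivative (z\<^sup>2 / (1 + z))) (at z within cball 0 \<bar>s\<bar>)"
      unfolding f_def using z1
      by (auto intro!: derivative_eq_intros simp: field_simps power2_eq_square)
    have "z\<^sup>2 \<le> s\<^sup>2" using z by (simp add: abs_le_square_iff)
    moreover have "z\<^sup>2 / (1 + z) \<le> z\<^sup>2 / (1 / 2)" by (rule divide_left_mono) (use z1 in auto)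
    ultimately show "norm (z\<^sup>2 / (1 + z)) \<le> 2 * s\<^sup>2" using z1 by simp
  qed (auto simp: dist_real_def)
  then show ?thesis by (simp add: f_def power3_eq_cube power2_eq_square abs_mult mult.assoc flip: abs_mult)
qed

text \<open>The logarithm turns moments into the first two cumulants. No smallness of b is assumed,
  since Gaussian energies are unbounded: for b \<le> 1/4 both Taylor remainders apply, and for
  larger b every term is itself dominated by a multiple of b^3. The constant 1000 is
  generous.\<close>

lemma (in prob_space) log_laplace_expansion:
  fixes u :: "'a \<Rightarrow> real"
  assumes [measurable]: "u \<in> borel_measurable M" and u: "\<And>x. x \<in> space M \<Longrightarrow> \<bar>u x\<bar> \<le> b"
  shows "\<bar>ln (\<integral>x. exp (u x) \<partial>M) - (\<integral>x. u x \<partial>M) - ((\<integral>x. (u x)\<^sup>2 \<partial>M) - (\<integral>x. u x \<partial>M)\<^sup>2) / 2\<bar>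
    \<le> 1000 * b ^ 3"
proof -
  obtain x where "x \<in> space M" using not_empty by blast
  then have b0: "0 \<le> b" using u by fastforce
  have i1: "integrable M u" by (rule integrable_const_bound[of _ b]) (auto intro: u)
  have u2: "(u x)\<^sup>2 \<le> b\<^sup>2" if "x \<in> space M" for x
    using u[OF that] b0 by (simp add: power2_le_iff_abs_le)
  have i2: "integrable M (\<lambda>x. (u x)\<^sup>2)"
    by (rule integrable_const_bound[of _ "b\<^sup>2"]) (auto intro: u2)
  have i3: "integrable M (\<lambda>x. exp (u x))"
    by (rule integrable_const_bound[of _ "exp b"]) (use u in \<open>force+\<close>)
  let ?u1 = "\<integral>x. u x \<partial>M" and ?u2 = "\<integral>x. (u x)\<^sup>2 \<partial>M" and ?e = "\<integral>x. exp (u x) \<partial>M"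
  have B1: "\<bar>?u1\<bar> \<le> b"
    by (intro order.trans[OF integral_abs_bound] integral_le_const) (auto intro: u i1)
  have B2: "0 \<le> ?u2" "?u2 \<le> b\<^sup>2"
    by (auto intro!: integral_le_const i2 u2)
  show ?thesis
  proof (cases "b \<le> 1 / 4")
    case True
    define s where "s = ?e - 1"
    define \<rho> where "\<rho> = (\<integral>x. exp (u x) - 1 - u x - (u x)\<^sup>2 / 2 \<partial>M)"
    have \<rho>: "\<bar>\<rho>\<bar> \<le> b ^ 3"
      unfolding \<rho>_def
      by (intro order.trans[OF integral_abs_bound] integral_le_const)
        (use i1 i2 i3 True in \<open>auto intro!: exp_cubic_remainder u\<close>)
    have s: "s = ?u1 + ?u2 / 2 + \<rho>"
      unfolding s_def \<rho>_def using i1 i2 i3 by (simp add: prob_space)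
    \<comment> \<open>The part of s of second order: b^2 / 2 + b^3 \<le> b^2 for b \<le> 1/4.
      Replacing s^2 by the square of the mean of u then costs d * (s + ?u1), which is
      O(b^3).\<close>
    define d where "d = ?u2 / 2 + \<rho>"
    have b3: "b ^ 3 \<le> b\<^sup>2 / 4" "b\<^sup>2 \<le> b / 4" "0 \<le> b ^ 3"
      using mult_right_mono[OF True, of "b\<^sup>2"] mult_right_mono[OF True, of b] b0
      by (auto simp: power3_eq_cube power2_eq_square)
    have d: "\<bar>d\<bar> \<le> b\<^sup>2" unfolding d_def using \<rho> B2 b3 by linarith
    have sd: "s = ?u1 + d" by (simp add: s d_def)
    have sb: "\<bar>s\<bar> \<le> 2 * b" using d B1 b3 b0 unfolding sd by linarith
    have "\<bar>ln (1 + s) - s + s\<^sup>2 / 2\<bar> \<le> 2 * \<bar>s\<bar> ^ 3"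
      by (rule ln_cubic_remainder) (use sb True in linarith)
    also have "\<dots> \<le> 2 * (2 * b) ^ 3" by (intro mult_left_mono power_mono sb) auto
    finally have L: "\<bar>ln (1 + s) - s + s\<^sup>2 / 2\<bar> \<le> 16 * b ^ 3" by (simp add: power_mult_distrib)
    have "s\<^sup>2 - ?u1\<^sup>2 = d * (s + ?u1)" unfolding sd by (simp add: power2_eq_square algebra_simps)
    moreover have "\<bar>d * (s + ?u1)\<bar> \<le> b\<^sup>2 * (3 * b)"
      unfolding abs_mult by (intro mult_mono d) (use sb B1 in auto)
    ultimately have Q: "\<bar>s\<^sup>2 - ?u1\<^sup>2\<bar> \<le> 3 * b ^ 3" by (simp add: power3_eq_cube power2_eq_square)
    have "ln ?e - ?u1 - (?u2 - ?u1\<^sup>2) / 2 = (ln (1 + s) - s + s\<^sup>2 / 2) + \<rho> - (s\<^sup>2 - ?u1\<^sup>2) / 2"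
      using s by (simp add: s_def field_simps)
    moreover have "\<bar>x + y - z / 2\<bar> \<le> 1000 * B"
      if "\<bar>x\<bar> \<le> 16 * B" "\<bar>y\<bar> \<le> B" "\<bar>z\<bar> \<le> 3 * B" "0 \<le> B" for x y z B :: real
      using that by linarith
    ultimately show ?thesis using L \<rho> Q b3(3) by metis
  next
    case False
    \<comment> \<open>For b > 1/4 the terms are bounded separately, by 2 * b + b^2 in total, and b
      \<le> 4 * b^2 \<le> 16 * b^3.\<close>
    have "exp (- b) \<le> ?e" "?e \<le> exp b"
      by (rule integral_ge_const[OF i3], use u in \<open>force simp: abs_le_iff\<close>)
        (rule integral_le_const[OF i3], use u in \<open>force simp: abs_le_iff\<close>)
    then have "\<bar>ln ?e\<bar> \<le> b"
      using exp_gt_zero[of "-b"] by (smt (verit) ln_exp ln_le_cancel_iff exp_gt_zero)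
    have "?u1\<^sup>2 \<le> b\<^sup>2" using B1 b0 by (simp add: power2_le_iff_abs_le)
    have *: "\<bar>ln ?e - ?u1 - (?u2 - ?u1\<^sup>2) / 2\<bar> \<le> 2 * b + b\<^sup>2"
    proof -
      have "\<bar>l - x - (y - z) / 2\<bar> \<le> 2 * b + c"
        if "\<bar>l\<bar> \<le> b" "\<bar>x\<bar> \<le> b" "0 \<le> y" "y \<le> c" "0 \<le> z" "z \<le> c" for l x y z c :: real
        using that unfolding diff_divide_distrib abs_le_iff by auto
      from this[OF _ B1 B2 zero_le_power2] show ?thesis
        using \<open>\<bar>ln ?e\<bar> \<le> b\<close> \<open>?u1\<^sup>2 \<le> b\<^sup>2\<close> by blast
    qed
    have "b\<^sup>2 \<le> 4 * b ^ 3" "b \<le> 4 * b\<^sup>2"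
      using False b0 mult_left_mono[of 1 "4 * b" "b\<^sup>2"] mult_left_mono[of 1 "4 * b" b]
      by (auto simp: power3_eq_cube power2_eq_square)
    with * b0 show ?thesis by (smt (verit) zero_le_power)
  qed
qed

text \<open>Here m is the size of one edge variable and m0 an upper bound for it. T * m bounds the
  exponent, and T' * m^2 bounds the exponent minus its linear part p * a, so second moments may be
  replaced by those of p * a at a cost of order m^3. P and Q stay explicit because p will depend on
  an unbounded noise variable, over which the error is integrated later.\<close>

lemma (in prob_space) log_laplace_quadratic:
  fixes a r :: "'a \<Rightarrow> real"
  assumes [measurable]: "a \<in> borel_measurable M" "r \<in> borel_measurable M"
    and a: "\<And>x. x \<in> space M \<Longrightarrow> \<bar>a x\<bar> \<le> m"
    and r: "\<And>x. x \<in> space M \<Longrightarrow> \<bar>r x\<bar> \<le> R * m ^ 3"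
    and p: "\<bar>p\<bar> \<le> P" and q: "\<bar>q\<bar> \<le> Q" and R: "0 \<le> R" and m: "m \<le> m0"
  defines "A1 \<equiv> \<integral>x. a x \<partial>M" and "A2 \<equiv> \<integral>x. (a x)\<^sup>2 \<partial>M"
    and "T \<equiv> P + Q * m0 + R * m0\<^sup>2" and "T' \<equiv> Q + R * m0"
  shows "\<bar>ln (\<integral>x. exp (p * a x + q * (a x)\<^sup>2 / 2 + r x) \<partial>M) - (p * A1 + q * A2 / 2 + p\<^sup>2 * (A2 - A1\<^sup>2) / 2)\<bar>
    \<le> (1000 * T ^ 3 + R + 2 * T * T') * m ^ 3"
proof -
  define u where "u x = p * a x + q * (a x)\<^sup>2 / 2 + r x" for x
  have [measurable]: "u \<in> borel_measurable M" unfolding u_def by measurable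
  obtain x where "x \<in> space M" using not_empty by blast
  then have m_nn: "0 \<le> m" using a by fastforce
  have nn: "0 \<le> P" "0 \<le> Q" "0 \<le> m0" using p q m m_nn by auto
  have T: "0 \<le> T" "0 \<le> T'" "\<bar>p\<bar> \<le> T" using nn R p by (auto simp: T_def T'_def intro!: add_increasing2)
  have m2: "m\<^sup>2 \<le> m0 * m" "m ^ 3 \<le> m0 * m\<^sup>2" "m ^ 3 \<le> m0\<^sup>2 * m"
    using mult_right_mono[OF m m_nn] mult_right_mono[OF m, of "m\<^sup>2"]
      mult_right_mono[OF power_mono[OF m m_nn, of 2] m_nn]
    by (simp_all add: power2_eq_square power3_eq_cube)
  have a2: "(a x)\<^sup>2 \<le> m\<^sup>2" if "x \<in> space M" for x
    using a[OF that] m_nn by (simp add: power2_le_iff_abs_le)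
  have d: "\<bar>u x - p * a x\<bar> \<le> T' * m\<^sup>2" if x: "x \<in> space M" for x
  proof -
    have "\<bar>q * (a x)\<^sup>2 / 2\<bar> \<le> Q * m\<^sup>2"
    proof -
      have "\<bar>q\<bar> * (a x)\<^sup>2 \<le> Q * m\<^sup>2" using nn by (intro mult_mono q a2[OF x]) auto
      moreover have "0 \<le> Q * m\<^sup>2" using nn by simp
      moreover have "\<bar>q * (a x)\<^sup>2 / 2\<bar> = \<bar>q\<bar> * (a x)\<^sup>2 / 2" by (simp add: abs_mult)
      ultimately show ?thesis by linarith
    qed
    moreover have "\<bar>r x\<bar> \<le> R * (m0 * m\<^sup>2)"
      using r[OF x] mult_left_mono[OF m2(2) R] by linarith
    ultimately show ?thesis by (simp add: u_def T'_def algebra_simps)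
  qed
  have pa: "\<bar>p * a x\<bar> \<le> P * m" if x: "x \<in> space M" for x
    using mult_mono[OF p a[OF x]] nn by (simp add: abs_mult)
  have ub: "\<bar>u x\<bar> \<le> T * m" if x: "x \<in> space M" for x
  proof -
    have "T' * m\<^sup>2 \<le> T' * (m0 * m)" by (intro mult_left_mono m2 T)
    then show ?thesis using d[OF x] pa[OF x] by (simp add: T_def T'_def algebra_simps power2_eq_square)
  qed
  have pa': "\<bar>p * a x\<bar> \<le> T * m" if x: "x \<in> space M" for x
    using mult_mono[OF T(3) a[OF x]] T by (simp add: abs_mult)
  have bd: "integrable M f" if "f \<in> borel_measurable M" "\<And>x. x \<in> space M \<Longrightarrow> \<bar>f x\<bar> \<le> B" for f :: "'a \<Rightarrow> real" and B
    by (rule integrable_const_bound[of _ B]) (use that in auto)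
  have ia: "integrable M a" by (rule bd) (auto intro: a)
  have ia2: "integrable M (\<lambda>x. (a x)\<^sup>2)" by (rule bd[of _ "m\<^sup>2"]) (auto intro: a2)
  have ir: "integrable M r" by (rule bd[of _ "R * m^3"]) (auto intro: r)
  have iu: "integrable M u" by (rule bd[of _ "T * m"]) (auto intro: ub)
  have u2: "(u x)\<^sup>2 \<le> (T * m)\<^sup>2" if "x \<in> space M" for x
    using ub[OF that] T m_nn by (simp add: power2_le_iff_abs_le)
  have iu2: "integrable M (\<lambda>x. (u x)\<^sup>2)" by (rule bd[of _ "(T * m)\<^sup>2"]) (auto intro: u2)
  let ?U1 = "\<integral>x. u x \<partial>M" and ?U2 = "\<integral>x. (u x)\<^sup>2 \<partial>M"
  have int_bd: "\<bar>\<integral>x. f x \<partial>M\<bar> \<le> B" if "f \<in> borel_measurable M" "\<And>x. x \<in> space M \<Longrightarrow> \<bar>f x\<bar> \<le> B" for f :: "'a \<Rightarrow> real" and B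
    by (intro order.trans[OF integral_abs_bound] integral_le_const) (use that in \<open>auto intro: bd\<close>)
  have main: "\<bar>ln (\<integral>x. exp (u x) \<partial>M) - ?U1 - (?U2 - ?U1\<^sup>2) / 2\<bar> \<le> 1000 * (T * m) ^ 3"
    by (rule log_laplace_expansion) (auto intro: ub)
  have U1: "?U1 = p * A1 + q * A2 / 2 + (\<integral>x. r x \<partial>M)"
    unfolding u_def A1_def A2_def using ia ia2 ir by simp
  have r1: "\<bar>\<integral>x. r x \<partial>M\<bar> \<le> R * m ^ 3" by (rule int_bd) (auto intro: r)
  \<comment> \<open>A difference of squares: one factor is O(m^2), the other O(m).\<close>
  have diff2: "\<bar>?U2 - p\<^sup>2 * A2\<bar> \<le> (T' * m\<^sup>2) * (2 * (T * m))"
  proof -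
    have "?U2 - p\<^sup>2 * A2 = (\<integral>x. (u x - p * a x) * (u x + p * a x) \<partial>M)"
      unfolding A2_def using iu2 ia2
      by (subst integral_mult_right_zero[symmetric], subst Bochner_Integration.integral_diff[symmetric])
        (auto simp: algebra_simps power2_eq_square)
    also have "\<bar>\<dots>\<bar> \<le> (T' * m\<^sup>2) * (2 * (T * m))"
    proof (rule int_bd)
      fix x assume x: "x \<in> space M"
      show "\<bar>(u x - p * a x) * (u x + p * a x)\<bar> \<le> (T' * m\<^sup>2) * (2 * (T * m))"
        unfolding abs_mult by (intro mult_mono d x) (use ub[OF x] pa'[OF x] T in auto)
    qed measurable
    finally show ?thesis .
  qed
  have diff1: "\<bar>?U1\<^sup>2 - (p * A1)\<^sup>2\<bar> \<le> (T' * m\<^sup>2) * (2 * (T * m))"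
  proof -
    have "\<bar>?U1 - p * A1\<bar> \<le> T' * m\<^sup>2"
    proof -
      have "?U1 - p * A1 = (\<integral>x. u x - p * a x \<partial>M)" unfolding A1_def using iu ia by simp
      then show ?thesis using int_bd[of "\<lambda>x. u x - p * a x" "T' * m\<^sup>2"] d by simp
    qed
    moreover have "\<bar>?U1\<bar> \<le> T * m" by (rule int_bd) (auto intro: ub)
    moreover have "\<bar>p * A1\<bar> \<le> T * m"
      using int_bd[of "\<lambda>x. p * a x" "T * m"] pa' by (simp add: A1_def)
    moreover have "?U1\<^sup>2 - (p * A1)\<^sup>2 = (?U1 - p * A1) * (?U1 + p * A1)"
      by (simp add: power2_eq_square algebra_simps)
    moreover have "\<bar>?U1 + p * A1\<bar> \<le> 2 * (T * m)" using calculation(2,3) by linarith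
    ultimately show ?thesis using T by (simp add: abs_mult mult_mono)
  qed
  have "ln (\<integral>x. exp (u x) \<partial>M) - (p * A1 + q * A2 / 2 + p\<^sup>2 * (A2 - A1\<^sup>2) / 2)
    = (ln (\<integral>x. exp (u x) \<partial>M) - ?U1 - (?U2 - ?U1\<^sup>2) / 2) + (\<integral>x. r x \<partial>M)
      + (?U2 - p\<^sup>2 * A2) / 2 - (?U1\<^sup>2 - (p * A1)\<^sup>2) / 2"
    by (simp add: U1 field_simps power_mult_distrib)
  moreover have "(1000 * T ^ 3 + R + 2 * T * T') * m ^ 3
    = 1000 * (T * m) ^ 3 + R * m ^ 3 + (T' * m\<^sup>2) * (2 * (T * m))"
    by (simp add: power_mult_distrib algebra_simps power2_eq_square power3_eq_cube)
  ultimately show ?thesis using main r1 diff1 diff2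
    unfolding u_def[symmetric] diff_divide_distrib by linarith
qed


section \<open>Expansion of the channel at zero\<close>

lemma dw_0: "dw 0 f y = f y"
  by (simp add: dw_def fun_eq_iff)

lemma dw_Suc: "dw (Suc k) f y = deriv (dw k f y)"
  by (simp add: dw_def fun_eq_iff dw_def[abs_def])

lemma times_differentiable_w_DERIV:
  assumes "times_differentiable_w n f" "k < n"
  shows "(dw k f y has_real_derivative dw (Suc k) f y w) (at w)"
  using assms unfolding times_differentiable_w_def
  by (simp add: dw_Suc DERIV_deriv_iff_real_differentiable)

lemma dw_Taylor:
  assumes "times_differentiable_w n f"
  shows "\<exists>t. \<bar>t\<bar> \<le> \<bar>w\<bar> \<and>
    f y w = (\<Sum>m<n. dw m f y 0 / fact m * w ^ m) + dw n f y t / fact n * w ^ n"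
  using Maclaurin_bi_le[of "\<lambda>m. dw m f y" "f y" n w] times_differentiable_w_DERIV[OF assms]
  by (simp add: dw_0)

text \<open>Each derivative is the pointwise limit of difference quotients with increments 1 / (n +
  1), so measurability in y passes through one derivative at a time.\<close>

lemma borel_measurable_dw:
  assumes f: "\<And>w. (\<lambda>y. f y w) \<in> borel_measurable borel"
    and d: "times_differentiable_w n f" and "k \<le> n"
  shows "(\<lambda>y. dw k f y w) \<in> borel_measurable borel"
  using \<open>k \<le> n\<close>
proof (induction k arbitrary: w)
  case 0
  then show ?case using f by (simp add: dw_0)
next
  case (Suc k)
  have [measurable]: "(\<lambda>y. dw k f y w) \<in> borel_measurable borel" for w using Suc by simp
  show ?case
  proof (rule borel_measurable_LIMSEQ_real)
    fix y
    have "(dw k f y has_real_derivative dw (Suc k) f y w) (at w)"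
      by (rule times_differentiable_w_DERIV[OF d]) (use Suc.prems in simp)
    then have "(\<lambda>h. (dw k f y (w + h) - dw k f y w) / h) \<midarrow>0\<rightarrow> dw (Suc k) f y w"
      by (simp add: DERIV_def)
    from LIMSEQ_SEQ_conv[THEN iffD2, OF this, rule_format, of "\<lambda>n. inverse (real (Suc n))"]
    show "(\<lambda>n. (dw k f y (w + inverse (real (Suc n))) - dw k f y w) / inverse (real (Suc n)))
        \<longlonglongrightarrow> dw (Suc k) f y w"
      using LIMSEQ_inverse_real_of_nat by simp
  qed measurable
qed

text \<open>\<open>channel_dominated\<close> speaks of the density exp (g0 y w), \<beta>_SNR of the
  derivative of g0; the chain rule links them.\<close>

lemma times_differentiable_w_exp:
  assumes "times_differentiable_w 2 f"
  shows "times_differentiable_w 2 (\<lambda>y w. exp (f y w))"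
    and "dw 1 (\<lambda>y w. exp (f y w)) y w = exp (f y w) * dw 1 f y w"
proof -
  have D0: "(f y has_real_derivative dw 1 f y w) (at w)" for y w
    using times_differentiable_w_DERIV[OF assms, of 0 y w] by (simp add: dw_0)
  have D1: "(dw 1 f y has_real_derivative dw 2 f y w) (at w)" for y w
    using times_differentiable_w_DERIV[OF assms, of 1] by (simp add: numeral_2_eq_2)
  have E0: "((\<lambda>w. exp (f y w)) has_real_derivative exp (f y w) * dw 1 f y w) (at w)" for y w
    by (rule derivative_eq_intros D0 refl)+
  show 1: "dw 1 (\<lambda>y w. exp (f y w)) y w = exp (f y w) * dw 1 f y w" for y w
    using DERIV_imp_deriv[OF E0] by (simp add: dw_0 dw_Suc)
  have "((\<lambda>w. exp (f y w) * dw 1 f y w) has_real_derivative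
      exp (f y w) * dw 1 f y w * dw 1 f y w + dw 2 f y w * exp (f y w)) (at w)" for y w
    by (rule DERIV_mult E0 D1)+
  then have "dw 1 (\<lambda>y w. exp (f y w)) y differentiable (at w)" for y w
    unfolding 1[abs_def] real_differentiable_def by blast
  moreover have "dw 0 (\<lambda>y w. exp (f y w)) y differentiable (at w)" for y w
    using E0 unfolding dw_0 real_differentiable_def by blast
  ultimately show "times_differentiable_w 2 (\<lambda>y w. exp (f y w))"
    unfolding times_differentiable_w_def by (auto simp: less_2_cases_iff)
qed

lemma borel_measurable_section:
  assumes "case_prod f \<in> borel_measurable (borel \<Otimes>\<^sub>M borel)"
  shows "(\<lambda>y. f y w) \<in> borel_measurable borel"
  using measurable_compose[OF measurable_Pair2' assms, of w] by simp

lemma integrable_lborel_exp_channel: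
  assumes g0: "case_prod g0 \<in> borel_measurable (borel \<Otimes>\<^sub>M borel)" and "prob_space (Pout g0 w)"
  shows "integrable lborel (\<lambda>y. exp (g0 y w))"
proof -
  interpret prob_space "Pout g0 w" by fact
  have [measurable]: "(\<lambda>y. g0 y w) \<in> borel_measurable borel" by (rule borel_measurable_section[OF g0])
  have "(\<integral>\<^sup>+ y. ennreal (exp (g0 y w)) \<partial>lborel) = emeasure (Pout g0 w) UNIV"
    unfolding Pout_def by (subst emeasure_density) (auto, measurable)
  also have "\<dots> < \<infinity>" using emeasure_space_1 by simp
  finally show ?thesis by (intro integrableI_bounded) (auto, measurable)
qed

lemma integral_Pout:
  assumes g0: "case_prod g0 \<in> borel_measurable (borel \<Otimes>\<^sub>M borel)"
    and [measurable]: "h \<in> borel_measurable borel"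
  shows "(\<integral>y. h y \<partial>Pout g0 w) = (\<integral>y. exp (g0 y w) * h y \<partial>lborel)"
proof -
  have [measurable]: "(\<lambda>y. g0 y w) \<in> borel_measurable borel" by (rule borel_measurable_section[OF g0])
  show ?thesis unfolding Pout_def by (subst integral_density) (auto, measurable)
qed

text \<open>Taylor expansion of the density under the integral, tested against a bounded h, with L
  independent of h. The score identity, that exp (g0 y w) has w-derivative exp (g0 y w) * dw 1 g0 y
  w, rewrites the first-order coefficient as an expectation under \<open>Pout g0 0\<close>. The
  quadratic bound serves the mean of \<open>dw 1 g y 0\<close>, the linear one the quantities that
  get multiplied by moments of order m^2.\<close>

lemma channel_expansion:
  fixes g0 :: "real \<Rightarrow> real \<Rightarrow> real"
  assumes g0: "case_prod g0 \<in> borel_measurable (borel \<Otimes>\<^sub>M borel)"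
    and channel: "\<And>w. prob_space (Pout g0 w)"
    and diff: "times_differentiable_w 2 g0" and dom: "channel_dominated g0"
  obtains \<delta> L where "\<delta> > 0" "L \<ge> 0"
    "\<And>h B w. h \<in> borel_measurable borel \<Longrightarrow> (\<And>y. \<bar>h y\<bar> \<le> B) \<Longrightarrow> \<bar>w\<bar> \<le> \<delta> \<Longrightarrow>
       \<bar>(\<integral>y. h y \<partial>Pout g0 w) - (\<integral>y. h y \<partial>Pout g0 0) - w * (\<integral>y. h y * dw 1 g0 y 0 \<partial>Pout g0 0)\<bar>
       \<le> B * L * w\<^sup>2"
    "\<And>h B w. h \<in> borel_measurable borel \<Longrightarrow> (\<And>y. \<bar>h y\<bar> \<le> B) \<Longrightarrow> \<bar>w\<bar> \<le> \<delta> \<Longrightarrow>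
       \<bar>(\<integral>y. h y \<partial>Pout g0 w) - (\<integral>y. h y \<partial>Pout g0 0)\<bar> \<le> B * L * \<bar>w\<bar>"
proof -
  let ?f = "\<lambda>y w. exp (g0 y w)"
  obtain \<delta> D where \<delta>: "\<delta> > 0" and D: "integrable lborel D"
    and bd: "\<And>y w. \<bar>w\<bar> \<le> \<delta> \<Longrightarrow> \<bar>dw 2 ?f y w\<bar> \<le> D y"
    using dom unfolding channel_dominated_def by blast
  note f2 = times_differentiable_w_exp[OF diff]
  have g0m [measurable]: "(\<lambda>y. g0 y w) \<in> borel_measurable borel" for w
    by (rule borel_measurable_section[OF g0])
  have f_int: "integrable lborel (\<lambda>y. ?f y w)" for w
    by (rule integrable_lborel_exp_channel[OF g0 channel])
  define f1 where "f1 y = dw 1 ?f y 0" for y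
  have f1m [measurable]: "f1 \<in> borel_measurable borel"
    using borel_measurable_dw[OF _ f2(1), of 1 0] unfolding f1_def by simp
  have g01 [measurable]: "(\<lambda>y. dw 1 g0 y 0) \<in> borel_measurable borel"
    by (rule borel_measurable_dw[OF g0m diff]) simp
  have taylor: "\<bar>?f y w - ?f y 0 - w * f1 y\<bar> \<le> w\<^sup>2 * D y" if w: "\<bar>w\<bar> \<le> \<delta>" for y w
  proof -
    obtain t where t: "\<bar>t\<bar> \<le> \<bar>w\<bar>"
      "?f y w = (\<Sum>m<2. dw m ?f y 0 / fact m * w ^ m) + dw 2 ?f y t / fact 2 * w ^ 2"
      using dw_Taylor[OF f2(1)] by blast
    have "?f y w - ?f y 0 - w * f1 y = dw 2 ?f y t / 2 * w\<^sup>2"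
      using t(2) by (simp add: f1_def numeral_2_eq_2 dw_0)
    also have "\<bar>\<dots>\<bar> \<le> D y * w\<^sup>2"
      unfolding abs_mult using bd[of t y] t(1) w by (intro mult_mono) auto
    finally show ?thesis by (simp add: mult.commute)
  qed
  \<comment> \<open>Integrability of f1 comes from the Taylor estimate at the single point w =
    \<delta>: \<delta> * |f1| is at most the two densities plus \<delta>^2 * D.\<close>
  have f1_int: "integrable lborel f1"
  proof (rule Bochner_Integration.integrable_bound)
    show "integrable lborel (\<lambda>y. (?f y \<delta> + ?f y 0 + \<delta>\<^sup>2 * D y) / \<delta>)"
      by (intro Bochner_Integration.integrable_divide Bochner_Integration.integrable_add f_int
          Bochner_Integration.integrable_mult_right D)
    show "AE y in lborel. norm (f1 y) \<le> norm ((?f y \<delta> + ?f y 0 + \<delta>\<^sup>2 * D y) / \<delta>)"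
    proof (rule AE_I2)
      fix y
      have "\<bar>\<delta> * f1 y\<bar> \<le> ?f y \<delta> + ?f y 0 + \<delta>\<^sup>2 * D y"
        using taylor[of \<delta> y] \<delta> exp_gt_zero[of "g0 y \<delta>"] exp_gt_zero[of "g0 y 0"] by linarith
      then show "norm (f1 y) \<le> norm ((?f y \<delta> + ?f y 0 + \<delta>\<^sup>2 * D y) / \<delta>)"
        using \<delta> by (simp add: abs_mult field_simps)
    qed
  qed simp
  \<comment> \<open>Covers both bounds: the integral of D for the quadratic one, and the integral of
    |f1| plus \<delta> times that of D for the linear one, where w^2 \<le> \<delta> * |w|.\<close>
  define L where "L = (\<integral>y. \<bar>f1 y\<bar> \<partial>lborel) + (1 + \<delta>) * (\<integral>y. D y \<partial>lborel)"
  have D0: "0 \<le> D y" for y using bd[of 0 y] \<delta> by (auto intro: order.trans[OF abs_ge_zero])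
  have ID: "0 \<le> (\<integral>y. D y \<partial>lborel)" and If: "0 \<le> (\<integral>y. \<bar>f1 y\<bar> \<partial>lborel)" by (simp_all add: D0)
  have L: "0 \<le> L" "(\<integral>y. D y \<partial>lborel) \<le> L" "(\<integral>y. \<bar>f1 y\<bar> \<partial>lborel) + \<delta> * (\<integral>y. D y \<partial>lborel) \<le> L"
    using ID If \<delta> mult_nonneg_nonneg[of \<delta> "\<integral>y. D y \<partial>lborel"] unfolding L_def distrib_right
    by auto
  have eq: "(\<integral>y. h y * dw 1 g0 y 0 \<partial>Pout g0 0) = (\<integral>y. h y * f1 y \<partial>lborel)"
    if [measurable]: "h \<in> borel_measurable borel" for h
    using g01 by (subst integral_Pout[OF g0]) (simp_all add: f1_def f2(2) mult_ac del: One_nat_def)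
  have bnd_int: "integrable lborel (\<lambda>y. h y * k y)"
    if "h \<in> borel_measurable borel" "\<And>y. \<bar>h y\<bar> \<le> B" "integrable lborel k" for h k :: "real \<Rightarrow> real" and B
  proof (rule Bochner_Integration.integrable_bound[of _ "\<lambda>y. B * k y"])
    show "AE y in lborel. norm (h y * k y) \<le> norm (B * k y)"
      using that(2) by (auto intro!: AE_I2 mult_right_mono simp: abs_mult) (meson abs_ge_self order.trans)
  qed (use that in auto)
  have main: "\<bar>(\<integral>y. h y \<partial>Pout g0 w) - (\<integral>y. h y \<partial>Pout g0 0) - w * (\<integral>y. h y * f1 y \<partial>lborel)\<bar>
      \<le> B * (\<integral>y. D y \<partial>lborel) * w\<^sup>2"
    if h [measurable]: "h \<in> borel_measurable borel" and hB: "\<And>y. \<bar>h y\<bar> \<le> B" and w: "\<bar>w\<bar> \<le> \<delta>" for h B w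
  proof -
    note i = bnd_int[OF h hB]
    have "(\<integral>y. h y \<partial>Pout g0 w) - (\<integral>y. h y \<partial>Pout g0 0) - w * (\<integral>y. h y * f1 y \<partial>lborel)
        = (\<integral>y. h y * ?f y w \<partial>lborel) - (\<integral>y. h y * ?f y 0 \<partial>lborel) - w * (\<integral>y. h y * f1 y \<partial>lborel)"
      by (simp add: integral_Pout[OF g0] mult.commute)
    also have "\<dots> = (\<integral>y. h y * ?f y w - h y * ?f y 0 - w * (h y * f1 y) \<partial>lborel)"
      using i[OF f_int] i[OF f1_int] by simp
    also have "\<bar>\<dots>\<bar> \<le> (\<integral>y. B * w\<^sup>2 * D y \<partial>lborel)"
    proof (rule order.trans[OF integral_abs_bound integral_mono])
      show "integrable lborel (\<lambda>y. \<bar>h y * ?f y w - h y * ?f y 0 - w * (h y * f1 y)\<bar>)"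
        using i[OF f_int] i[OF f1_int] by simp
      show "integrable lborel (\<lambda>y. B * w\<^sup>2 * D y)" using D by simp
      fix y
      have "h y * ?f y w - h y * ?f y 0 - w * (h y * f1 y) = h y * (?f y w - ?f y 0 - w * f1 y)"
        by (simp add: algebra_simps)
      also have "\<bar>\<dots>\<bar> \<le> B * (w\<^sup>2 * D y)"
        unfolding abs_mult[of "h y"] by (intro mult_mono hB taylor w) (use hB[of y] in auto)
      finally show "\<bar>h y * ?f y w - h y * ?f y 0 - w * (h y * f1 y)\<bar> \<le> B * w\<^sup>2 * D y"
        by (simp add: mult.assoc)
    qed
    finally show ?thesis by (simp add: mult_ac)
  qed
  show ?thesis
  proof (rule that[OF \<delta> L(1)])
    fix h :: "real \<Rightarrow> real" and B w :: real assume h: "h \<in> borel_measurable borel" and hB: "\<And>y. \<bar>h y\<bar> \<le> B" and w: "\<bar>w\<bar> \<le> \<delta>"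
    have B: "0 \<le> B" using hB[of 0] by linarith
    have "B * (\<integral>y. D y \<partial>lborel) * w\<^sup>2 \<le> B * L * w\<^sup>2" by (intro mult_right_mono mult_left_mono L B) auto
    with main[OF h hB w]
    show "\<bar>(\<integral>y. h y \<partial>Pout g0 w) - (\<integral>y. h y \<partial>Pout g0 0) - w * (\<integral>y. h y * dw 1 g0 y 0 \<partial>Pout g0 0)\<bar>
       \<le> B * L * w\<^sup>2" unfolding eq[OF h] by linarith
    have "\<bar>\<integral>y. h y * f1 y \<partial>lborel\<bar> \<le> (\<integral>y. B * \<bar>f1 y\<bar> \<partial>lborel)"
      by (intro order.trans[OF integral_abs_bound integral_mono] integrable_abs
          bnd_int[OF h hB f1_int] integrable_mult_right f1_int)
        (simp add: abs_mult hB mult_right_mono)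
    then have "\<bar>w * (\<integral>y. h y * f1 y \<partial>lborel)\<bar> \<le> \<bar>w\<bar> * (B * (\<integral>y. \<bar>f1 y\<bar> \<partial>lborel))"
      unfolding abs_mult by (intro mult_left_mono) auto
    moreover have "B * (\<integral>y. D y \<partial>lborel) * w\<^sup>2 \<le> \<bar>w\<bar> * (B * (\<delta> * (\<integral>y. D y \<partial>lborel)))"
      using mult_right_mono[OF mult_left_mono[OF w, of "\<bar>w\<bar>"], of "B * (\<integral>y. D y \<partial>lborel)"] B ID
      by (simp add: power2_eq_square mult_ac)
    ultimately have "\<bar>(\<integral>y. h y \<partial>Pout g0 w) - (\<integral>y. h y \<partial>Pout g0 0)\<bar>
        \<le> \<bar>w\<bar> * (B * ((\<integral>y. \<bar>f1 y\<bar> \<partial>lborel) + \<delta> * (\<integral>y. D y \<partial>lborel)))"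
      using main[OF h hB w] unfolding distrib_left by linarith
    also have "\<dots> \<le> \<bar>w\<bar> * (B * L)" by (intro mult_left_mono L B) auto
    finally show "\<bar>(\<integral>y. h y \<partial>Pout g0 w) - (\<integral>y. h y \<partial>Pout g0 0)\<bar> \<le> B * L * \<bar>w\<bar>"
      by (simp add: mult_ac)
  qed
qed


section \<open>Comparison of a single pair\<close>

lemma prob_space_std_normal: "prob_space std_normal_distribution"
  by (rule prob_space_normal_density) simp

lemma integrable_std_normal_abs_power: "integrable std_normal_distribution (\<lambda>y. \<bar>y\<bar> ^ k)"
  using integrable_std_normal_moment_abs[of k] by (subst integrable_density) auto

lemma std_normal_moments:
  "integrable std_normal_distribution (\<lambda>y. y)" "(\<integral>y. y \<partial>std_normal_distribution) = 0"
  "integrable std_normal_distribution (\<lambda>y. y\<^sup>2)" "(\<integral>y. y\<^sup>2 \<partial>std_normal_distribution) = 1"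
  using integrable_std_normal_moment[of 1] integrable_std_normal_moment[of 2]
    integral_std_normal_moment_odd[of 0] integral_std_normal_moment_even[of 1]
  by (simp_all add: integrable_density integral_density)

lemma (in finite_measure) integrable_bounded:
  fixes f :: "'a \<Rightarrow> real"
  assumes "f \<in> borel_measurable M" "\<And>x. x \<in> space M \<Longrightarrow> \<bar>f x\<bar> \<le> B"
  shows "integrable M f"
  by (rule integrable_const_bound[of _ B]) (use assms in auto)

text \<open>Stated for finite measures because it is applied to the prior restricted to A. The total
  mass is then the probability of A, and its logarithm is the reference value of the log-partition
  function.\<close>

lemma (in finite_measure) log_integral_exp_bound:
  fixes f :: "'a \<Rightarrow> real"
  assumes [measurable]: "f \<in> borel_measurable M" and f: "\<And>x. x \<in> space M \<Longrightarrow> \<bar>f x\<bar> \<le> B"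
    and M: "measure M (space M) > 0"
  shows "(\<integral>x. exp (f x) \<partial>M) > 0"
    and "\<bar>ln (\<integral>x. exp (f x) \<partial>M) - ln (measure M (space M))\<bar> \<le> B"
proof -
  have i: "integrable M (\<lambda>x. exp (f x))"
    by (rule integrable_bounded[of _ "exp B"]) (use f in \<open>force+\<close>)
  have "(\<integral>x. exp (- B) \<partial>M) \<le> (\<integral>x. exp (f x) \<partial>M)" "(\<integral>x. exp (f x) \<partial>M) \<le> (\<integral>x. exp B \<partial>M)"
    by (rule integral_mono; use f i in \<open>force simp: abs_le_iff\<close>)+
  then have *: "measure M (space M) * exp (- B) \<le> (\<integral>x. exp (f x) \<partial>M)"
    "(\<integral>x. exp (f x) \<partial>M) \<le> measure M (space M) * exp B"
    by simp_all
  show pos: "(\<integral>x. exp (f x) \<partial>M) > 0" using *(1) M by (smt (verit) exp_gt_zero mult_pos_pos)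
  have "ln (measure M (space M) * exp (- B)) \<le> ln (\<integral>x. exp (f x) \<partial>M)"
    "ln (\<integral>x. exp (f x) \<partial>M) \<le> ln (measure M (space M) * exp B)"
    using * pos M by (simp_all add: ln_le_cancel_iff)
  then show "\<bar>ln (\<integral>x. exp (f x) \<partial>M) - ln (measure M (space M))\<bar> \<le> B"
    using M by (simp add: ln_mult abs_le_iff)
qed

text \<open>Integrability of \<Phi> is obtained on the way: \<Phi> differs from an explicitly
  integrable expression by at most \<kappa>.\<close>

lemma (in prob_space) expectation_expansion:
  fixes \<Phi> p q \<kappa> :: "'a \<Rightarrow> real"
  assumes [measurable]: "\<Phi> \<in> borel_measurable M"
    and i: "integrable M p" "integrable M q" "integrable M (\<lambda>y. (p y)\<^sup>2)" "integrable M \<kappa>"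
    and bd: "\<And>y. y \<in> space M \<Longrightarrow> \<bar>\<Phi> y - (p y * A1 + q y * A2 / 2 + (p y)\<^sup>2 * V / 2)\<bar> \<le> \<kappa> y"
  shows "\<bar>(\<integral>y. \<Phi> y \<partial>M) - ((\<integral>y. p y \<partial>M) * A1 + (\<integral>y. q y \<partial>M) * A2 / 2 + (\<integral>y. (p y)\<^sup>2 \<partial>M) * V / 2)\<bar>
    \<le> (\<integral>y. \<kappa> y \<partial>M)"
proof -
  let ?E = "\<lambda>y. p y * A1 + q y * A2 / 2 + (p y)\<^sup>2 * V / 2"
  have iE: "integrable M ?E" using i by simp
  have [measurable]: "?E \<in> borel_measurable M" using iE by (rule borel_measurable_integrable)
  have id: "integrable M (\<lambda>y. \<Phi> y - ?E y)"
    by (rule Bochner_Integration.integrable_bound[OF i(4)])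
      (use bd in \<open>force intro!: AE_I2\<close>)+
  have "integrable M (\<lambda>y. (\<Phi> y - ?E y) + ?E y)" using id iE by (rule Bochner_Integration.integrable_add)
  then have i\<Phi>: "integrable M \<Phi>" by simp
  have "(\<integral>y. \<Phi> y \<partial>M) - ((\<integral>y. p y \<partial>M) * A1 + (\<integral>y. q y \<partial>M) * A2 / 2 + (\<integral>y. (p y)\<^sup>2 \<partial>M) * V / 2)
      = (\<integral>y. \<Phi> y - ?E y \<partial>M)"
    using i\<Phi> iE i by simp
  also have "\<bar>\<dots>\<bar> \<le> (\<integral>y. \<kappa> y \<partial>M)"
    by (intro order.trans[OF integral_abs_bound integral_mono]) (use id i bd in auto)
  finally show ?thesis .
qed

lemma channel_Taylor:
  assumes "times_differentiable_w 3 g" and G3: "\<And>y w. \<bar>dw 3 g y w\<bar> \<le> G3"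
  shows "\<bar>g y w - g y 0 - (dw 1 g y 0 * w + dw 2 g y 0 * w\<^sup>2 / 2)\<bar> \<le> G3 * \<bar>w\<bar> ^ 3"
proof -
  obtain t where "g y w = (\<Sum>m<3. dw m g y 0 / fact m * w ^ m) + dw 3 g y t / fact 3 * w ^ 3"
    using dw_Taylor[OF assms(1)] by blast
  then have "g y w - g y 0 - (dw 1 g y 0 * w + dw 2 g y 0 * w\<^sup>2 / 2) = dw 3 g y t / 6 * w ^ 3"
    by (simp add: eval_nat_numeral fact_numeral dw_0)
  also have "\<bar>\<dots>\<bar> = \<bar>dw 3 g y t / 6\<bar> * \<bar>w\<bar> ^ 3" by (simp add: abs_mult power_abs)
  also have "\<dots> \<le> G3 * \<bar>w\<bar> ^ 3" using G3[of y t] by (intro mult_right_mono) auto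
  finally show ?thesis .
qed

text \<open>In both models the energy of a pair is p * a + q * a^2 / 2 up to third order: p = dw 1 g
  y 0, q = dw 2 g y 0 with y drawn from \<open>Pout g0 w\<close>, against p = \<beta> * y +
  \<beta>_SNR * w, q = \<beta>_S with y Gaussian. After averaging over y only the means of p, q and
  p^2 enter; they agree up to O(m^2), O(m) and O(m) and multiply A1 = O(m), A2 = O(m^2) and V =
  O(m^2). K may depend neither on \<mu>, which will be a tilted measure, nor on w, the edge variable
  of the signal.\<close>

lemma one_pair_comparison:
  fixes g g0 :: "real \<Rightarrow> real \<Rightarrow> real" and \<beta> \<beta>_SNR \<beta>_S m0 :: real
  assumes meas: "case_prod g \<in> borel_measurable (borel \<Otimes>\<^sub>M borel)"
      "case_prod g0 \<in> borel_measurable (borel \<Otimes>\<^sub>M borel)"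
    and channel: "\<And>w. prob_space (Pout g0 w)"
    and regular: "regularity_hyp g g0"
    and dominated: "channel_dominated g0"
    and consistent: "consistency_hyp g g0"
    and \<beta>: "\<beta> = sqrt (\<integral>y. (dw 1 g y 0)\<^sup>2 \<partial>Pout g0 0)"
    and \<beta>_SNR: "\<beta>_SNR = (\<integral>y. dw 1 g y 0 * dw 1 g0 y 0 \<partial>Pout g0 0)"
    and \<beta>_S: "\<beta>_S = (\<integral>y. dw 2 g y 0 \<partial>Pout g0 0)"
  obtains K \<delta> where "K \<ge> 0" "\<delta> > 0"
    "\<And>(\<mu> :: 'a measure) a m w. prob_space \<mu> \<Longrightarrow> a \<in> borel_measurable \<mu> \<Longrightarrow>
      (\<And>x. x \<in> space \<mu> \<Longrightarrow> \<bar>a x\<bar> \<le> m) \<Longrightarrow> m \<le> m0 \<Longrightarrow> \<bar>w\<bar> \<le> m \<Longrightarrow> \<bar>w\<bar> \<le> \<delta> \<Longrightarrow>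
      \<bar>(\<integral>y. ln (\<integral>x. exp (g y (a x) - g y 0) \<partial>\<mu>) \<partial>Pout g0 w)
        - (\<integral>y. ln (\<integral>x. exp (\<beta> * y * a x + \<beta>_SNR * w * a x + \<beta>_S * (a x)\<^sup>2 / 2) \<partial>\<mu>)
            \<partial>std_normal_distribution)\<bar> \<le> K * m ^ 3"
proof -
  have g3: "times_differentiable_w 3 g" and g02: "times_differentiable_w 2 g0"
    using regular by (auto simp: regularity_hyp_def)
  obtain G1 where G1: "\<And>y. \<bar>dw 1 g y 0\<bar> \<le> G1"
    using regular by (auto simp: regularity_hyp_def bounded_iff simp del: One_nat_def)
  obtain G2 where G2: "\<And>y. \<bar>dw 2 g y 0\<bar> \<le> G2"
    using regular by (auto simp: regularity_hyp_def bounded_iff)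
  obtain G3 where G3: "\<And>y w. \<bar>dw 3 g y w\<bar> \<le> G3"
    using regular by (auto simp: regularity_hyp_def bounded_iff)
  have G_nn: "0 \<le> G1" "0 \<le> G2" "0 \<le> G3"
    using G1[of 0] G2[of 0] G3[of 0 0] by linarith+
  define g1 where "g1 y = dw 1 g y 0" for y
  define g2 where "g2 y = dw 2 g y 0" for y
  have gm: "(\<lambda>y. g y w) \<in> borel_measurable borel" for w by (rule borel_measurable_section[OF meas(1)])
  have [measurable]: "g1 \<in> borel_measurable borel" "g2 \<in> borel_measurable borel"
    unfolding g1_def[abs_def] g2_def[abs_def] by (rule borel_measurable_dw[OF gm g3]; simp)+
  obtain \<delta> L where \<delta>: "\<delta> > 0" and L: "L \<ge> 0"
    and exp2: "\<And>h B w. h \<in> borel_measurable borel \<Longrightarrow> (\<And>y. \<bar>h y\<bar> \<le> B) \<Longrightarrow> \<bar>w\<bar> \<le> \<delta> \<Longrightarrow>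
       \<bar>(\<integral>y. h y \<partial>Pout g0 w) - (\<integral>y. h y \<partial>Pout g0 0) - w * (\<integral>y. h y * dw 1 g0 y 0 \<partial>Pout g0 0)\<bar>
       \<le> B * L * w\<^sup>2"
    and exp1: "\<And>h B w. h \<in> borel_measurable borel \<Longrightarrow> (\<And>y. \<bar>h y\<bar> \<le> B) \<Longrightarrow> \<bar>w\<bar> \<le> \<delta> \<Longrightarrow>
       \<bar>(\<integral>y. h y \<partial>Pout g0 w) - (\<integral>y. h y \<partial>Pout g0 0)\<bar> \<le> B * L * \<bar>w\<bar>"
    using channel_expansion[OF meas(2) channel g02 dominated] by blast
  \<comment> \<open>K1 is deterministic since the derivatives of g at 0 are bounded.
    \<open>TG\<close> is the counterpart of T for the coefficient \<beta> * y + \<beta>_SNR * w and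
    grows with |y|, so \<kappa> is a cubic polynomial in |y|, whose Gaussian mean is K2.\<close>
  define T where "T = G1 + G2 * m0 + G3 * m0\<^sup>2"
  define K1 where "K1 = 1000 * T ^ 3 + G3 + 2 * T * (G2 + G3 * m0)"
  define TG where "TG y = \<bar>\<beta>\<bar> * \<bar>y\<bar> + \<bar>\<beta>_SNR\<bar> * m0 + \<bar>\<beta>_S\<bar> * m0" for y :: real
  define \<kappa> where "\<kappa> y = 1000 * TG y ^ 3 + 2 * TG y * \<bar>\<beta>_S\<bar>" for y
  define K2 where "K2 = (\<integral>y. \<kappa> y \<partial>std_normal_distribution)"
  define K3 where "K3 = G1 * L + G2 * L + G1\<^sup>2 * L + \<beta>_SNR\<^sup>2 * m0"
  interpret Q: prob_space std_normal_distribution by (rule prob_space_std_normal)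
  have int_\<kappa>: "integrable std_normal_distribution \<kappa>"
  proof -
    define b c where "b = \<bar>\<beta>\<bar>" and "c = \<bar>\<beta>_SNR\<bar> * m0 + \<bar>\<beta>_S\<bar> * m0"
    have TG: "TG y = b * \<bar>y\<bar> + c" for y by (simp add: TG_def b_def c_def)
    have "\<kappa> = (\<lambda>y. 1000 * (b ^ 3 * \<bar>y\<bar> ^ 3 + 3 * b\<^sup>2 * c * \<bar>y\<bar>\<^sup>2 + 3 * b * c\<^sup>2 * \<bar>y\<bar> ^ 1 + c ^ 3)
        + 2 * (b * \<bar>y\<bar> ^ 1 + c) * \<bar>\<beta>_S\<bar>)"
      unfolding \<kappa>_def TG fun_eq_iff by (simp add: algebra_simps power2_eq_square power3_eq_cube)
    then show ?thesis
      by (simp only:) (intro Bochner_Integration.integrable_add integrable_mult_right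
          integrable_mult_left integrable_std_normal_abs_power Q.integrable_const)
  qed
  show ?thesis
  proof (rule that[OF _ \<delta>])
    \<comment> \<open>m0 is an arbitrary real; if it is negative no m qualifies, but the sum of
      constants could be negative too.\<close>
    show "0 \<le> max 0 (K1 + K2 + K3)" by simp
    fix \<mu> :: "'a measure" and a m w
    assume \<mu>: "prob_space \<mu>" and [measurable]: "a \<in> borel_measurable \<mu>"
      and a: "\<And>x. x \<in> space \<mu> \<Longrightarrow> \<bar>a x\<bar> \<le> m" and m: "m \<le> m0" and w: "\<bar>w\<bar> \<le> m" "\<bar>w\<bar> \<le> \<delta>"
    interpret \<mu>: prob_space \<mu> by fact
    interpret P: prob_space "Pout g0 w" by (rule channel)
    have m_nn: "0 \<le> m" "0 \<le> m0" using w m by linarith+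
    define A1 where "A1 = (\<integral>x. a x \<partial>\<mu>)"
    define A2 where "A2 = (\<integral>x. (a x)\<^sup>2 \<partial>\<mu>)"
    define V where "V = A2 - A1\<^sup>2"
    have ia: "integrable \<mu> a" by (rule \<mu>.integrable_bounded) (auto intro: a)
    have a2: "(a x)\<^sup>2 \<le> m\<^sup>2" if "x \<in> space \<mu>" for x
      using a[OF that] m_nn by (simp add: power2_le_iff_abs_le)
    have ia2: "integrable \<mu> (\<lambda>x. (a x)\<^sup>2)" by (rule \<mu>.integrable_bounded[of _ "m\<^sup>2"]) (auto intro: a2)
    have A1: "\<bar>A1\<bar> \<le> m" unfolding A1_def
      by (intro order.trans[OF integral_abs_bound] \<mu>.integral_le_const) (auto intro: a ia)
    have A2: "0 \<le> A2" "A2 \<le> m\<^sup>2" unfolding A2_def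
      by (auto intro!: \<mu>.integral_le_const ia2 a2)
    have "A1\<^sup>2 \<le> m\<^sup>2" using A1 m_nn by (simp add: power2_le_iff_abs_le)
    then have V: "\<bar>V\<bar> \<le> m\<^sup>2" using A2 zero_le_power2[of A1] unfolding V_def by linarith
    define \<Phi>1 where "\<Phi>1 y = ln (\<integral>x. exp (g y (a x) - g y 0) \<partial>\<mu>)" for y
    define \<Phi>2 where "\<Phi>2 y = ln (\<integral>x. exp (\<beta> * y * a x + \<beta>_SNR * w * a x + \<beta>_S * (a x)\<^sup>2 / 2) \<partial>\<mu>)" for y
    have [measurable]: "(\<lambda>p. g (fst p) (a (snd p))) \<in> borel_measurable (borel \<Otimes>\<^sub>M \<mu>)"
      using measurable_compose[OF _ meas(1), of "\<lambda>p. (fst p, a (snd p))" "borel \<Otimes>\<^sub>M \<mu>"] by simp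
    have [measurable]: "(\<lambda>x. g y (a x)) \<in> borel_measurable \<mu>" for y
      using measurable_compose[OF _ meas(1), of "\<lambda>x. (y, a x)" \<mu>] by simp
    note gm [measurable]
    have \<Phi>1m: "\<Phi>1 \<in> borel_measurable borel"
      unfolding \<Phi>1_def by measurable
    have \<Phi>2m: "\<Phi>2 \<in> borel_measurable borel"
      unfolding \<Phi>2_def by measurable
    define e1 where "e1 = (\<integral>y. g1 y \<partial>Pout g0 w)"
    define e2 where "e2 = (\<integral>y. g2 y \<partial>Pout g0 w)"
    define e3 where "e3 = (\<integral>y. (g1 y)\<^sup>2 \<partial>Pout g0 w)"
    have g12: "\<bar>(g1 y)\<^sup>2\<bar> \<le> G1\<^sup>2" for y
      using G1[of y] G_nn by (simp add: g1_def power2_le_iff_abs_le del: One_nat_def)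
    have X1: "\<bar>(\<integral>y. \<Phi>1 y \<partial>Pout g0 w) - (e1 * A1 + e2 * A2 / 2 + e3 * V / 2)\<bar>
        \<le> (\<integral>y. K1 * m ^ 3 \<partial>Pout g0 w)"
      unfolding e1_def e2_def e3_def
    proof (rule P.expectation_expansion)
      show "\<Phi>1 \<in> borel_measurable (Pout g0 w)" using \<Phi>1m by measurable
      show "integrable (Pout g0 w) g1" by (rule P.integrable_bounded[of _ G1]) (auto simp: g1_def G1 simp del: One_nat_def)
      show "integrable (Pout g0 w) g2" by (rule P.integrable_bounded[of _ G2]) (auto simp: g2_def G2)
      show "integrable (Pout g0 w) (\<lambda>y. (g1 y)\<^sup>2)"
        by (rule P.integrable_bounded[of _ "G1\<^sup>2"]) (use g12 in auto)
      fix y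
      define r where "r x = g y (a x) - g y 0 - (g1 y * a x + g2 y * (a x)\<^sup>2 / 2)" for x
      have [measurable]: "r \<in> borel_measurable \<mu>" unfolding r_def by measurable
      have rb: "\<bar>r x\<bar> \<le> G3 * m ^ 3" if x: "x \<in> space \<mu>" for x
      proof -
        have "\<bar>r x\<bar> \<le> G3 * \<bar>a x\<bar> ^ 3"
          unfolding r_def g1_def g2_def by (rule channel_Taylor[OF g3 G3])
        also have "\<dots> \<le> G3 * m ^ 3" by (intro mult_left_mono power_mono a x G_nn) simp
        finally show ?thesis .
      qed
      have G1': "\<bar>g1 y\<bar> \<le> G1" and G2': "\<bar>g2 y\<bar> \<le> G2"
        unfolding g1_def g2_def by (rule G1 G2)+
      have eq: "g1 y * a x + g2 y * (a x)\<^sup>2 / 2 + r x = g y (a x) - g y 0" for x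
        by (simp add: r_def)
      show "\<bar>\<Phi>1 y - (g1 y * A1 + g2 y * A2 / 2 + (g1 y)\<^sup>2 * V / 2)\<bar> \<le> K1 * m ^ 3"
        using \<mu>.log_laplace_quadratic[of a r m G3 "g1 y" G1 "g2 y" G2 m0] a rb G1' G2' G_nn m
        unfolding eq \<Phi>1_def[symmetric] A1_def[symmetric] A2_def[symmetric] V_def[symmetric]
          T_def[symmetric] K1_def[symmetric] by simp
    qed simp
    have X2: "\<bar>(\<integral>y. \<Phi>2 y \<partial>std_normal_distribution)
          - ((\<integral>y. \<beta> * y + \<beta>_SNR * w \<partial>std_normal_distribution) * A1
          + (\<integral>y. \<beta>_S \<partial>std_normal_distribution) * A2 / 2
          + (\<integral>y. (\<beta> * y + \<beta>_SNR * w)\<^sup>2 \<partial>std_normal_distribution) * V / 2)\<bar>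
        \<le> (\<integral>y. \<kappa> y * m ^ 3 \<partial>std_normal_distribution)"
    proof (rule Q.expectation_expansion)
      show "\<Phi>2 \<in> borel_measurable std_normal_distribution" using \<Phi>2m by simp
      show "integrable std_normal_distribution (\<lambda>y. \<beta> * y + \<beta>_SNR * w)"
        using std_normal_moments(1) by simp
      show "integrable std_normal_distribution (\<lambda>y. (\<beta> * y + \<beta>_SNR * w)\<^sup>2)"
        using std_normal_moments(1,3) by (simp add: power2_sum power_mult_distrib)
      show "integrable std_normal_distribution (\<lambda>y. \<kappa> y * m ^ 3)" using int_\<kappa> by simp
      fix y
      have "\<bar>\<beta>_SNR * w\<bar> \<le> \<bar>\<beta>_SNR\<bar> * m0" unfolding abs_mult using w m by (intro mult_left_mono) auto
      then have p: "\<bar>\<beta> * y + \<beta>_SNR * w\<bar> \<le> \<bar>\<beta>\<bar> * \<bar>y\<bar> + \<bar>\<beta>_SNR\<bar> * m0"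
        using abs_triangle_ineq[of "\<beta> * y" "\<beta>_SNR * w"] by (simp add: abs_mult)
      \<comment> \<open>The signal term is absorbed into the linear coefficient, as a shift of its
        mean by \<beta>_SNR * w; the cubic remainder is 0.\<close>
      have eq: "(\<beta> * y + \<beta>_SNR * w) * a x + \<beta>_S * (a x)\<^sup>2 / 2 + 0
          = \<beta> * y * a x + \<beta>_SNR * w * a x + \<beta>_S * (a x)\<^sup>2 / 2" for x
        by (simp add: algebra_simps)
      show "\<bar>\<Phi>2 y - ((\<beta> * y + \<beta>_SNR * w) * A1 + \<beta>_S * A2 / 2 + (\<beta> * y + \<beta>_SNR * w)\<^sup>2 * V / 2)\<bar>
          \<le> \<kappa> y * m ^ 3"
        using \<mu>.log_laplace_quadratic[of a "\<lambda>_. 0" m 0 "\<beta> * y + \<beta>_SNR * w" _ \<beta>_S "\<bar>\<beta>_S\<bar>" m0, OF _ _ a _ p] m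
        unfolding eq \<Phi>2_def[symmetric] A1_def[symmetric] A2_def[symmetric] V_def[symmetric]
        by (simp add: \<kappa>_def TG_def)
    qed simp
    have G: "(\<integral>y. \<beta> * y + \<beta>_SNR * w \<partial>std_normal_distribution) = \<beta>_SNR * w"
      "(\<integral>y. (\<beta> * y + \<beta>_SNR * w)\<^sup>2 \<partial>std_normal_distribution) = \<beta>\<^sup>2 + \<beta>_SNR\<^sup>2 * w\<^sup>2"
      using std_normal_moments Q.prob_space by (simp_all add: power2_sum power_mult_distrib)
    have w2: "w\<^sup>2 \<le> m\<^sup>2" using w m_nn by (simp add: power2_le_iff_abs_le)
    \<comment> \<open>Consistency removes the value at w = 0, and \<beta>_SNR is the first-order
      coefficient in w.\<close>
    have c1: "\<bar>e1 - \<beta>_SNR * w\<bar> \<le> G1 * L * m\<^sup>2"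
    proof -
      have "\<bar>e1 - \<beta>_SNR * w\<bar> \<le> G1 * L * w\<^sup>2"
        using exp2[of g1 G1 w] G1 w consistent
        by (simp add: e1_def consistency_hyp_def \<beta>_SNR g1_def mult.commute del: One_nat_def)
      also have "\<dots> \<le> G1 * L * m\<^sup>2" by (intro mult_left_mono w2 mult_nonneg_nonneg G_nn L)
      finally show ?thesis .
    qed
    have c2: "\<bar>e2 - \<beta>_S\<bar> \<le> G2 * L * m"
    proof -
      have "\<bar>e2 - \<beta>_S\<bar> \<le> G2 * L * \<bar>w\<bar>"
        using exp1[of g2 G2 w] G2 w by (simp add: e2_def \<beta>_S g2_def)
      also have "\<dots> \<le> G2 * L * m" by (intro mult_left_mono w mult_nonneg_nonneg G_nn L)
      finally show ?thesis .
    qed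
    \<comment> \<open>The shift of p also adds \<beta>_SNR^2 * w^2 to the Gaussian second moment,
      which nothing in the inference model matches; being O(m^2), it fits into the allowed
      O(m).\<close>
    have c3: "\<bar>e3 - (\<beta>\<^sup>2 + \<beta>_SNR\<^sup>2 * w\<^sup>2)\<bar> \<le> (G1\<^sup>2 * L + \<beta>_SNR\<^sup>2 * m0) * m"
    proof -
      have "\<beta>\<^sup>2 = (\<integral>y. (g1 y)\<^sup>2 \<partial>Pout g0 0)" unfolding \<beta> g1_def by simp
      then have "\<bar>e3 - \<beta>\<^sup>2\<bar> \<le> G1\<^sup>2 * L * \<bar>w\<bar>"
        using exp1[of "\<lambda>y. (g1 y)\<^sup>2" "G1\<^sup>2" w] g12 w by (simp add: e3_def)
      also have "\<dots> \<le> G1\<^sup>2 * L * m" by (intro mult_left_mono w mult_nonneg_nonneg L) simp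
      finally have "\<bar>e3 - \<beta>\<^sup>2\<bar> \<le> G1\<^sup>2 * L * m" .
      moreover have "\<beta>_SNR\<^sup>2 * w\<^sup>2 \<le> \<beta>_SNR\<^sup>2 * (m0 * m)"
        using w2 mult_right_mono[OF m m_nn(1)] by (intro mult_left_mono) (auto simp: power2_eq_square)
      moreover have "0 \<le> \<beta>_SNR\<^sup>2 * w\<^sup>2" by simp
      ultimately have "\<bar>e3 - (\<beta>\<^sup>2 + \<beta>_SNR\<^sup>2 * w\<^sup>2)\<bar> \<le> G1\<^sup>2 * L * m + \<beta>_SNR\<^sup>2 * (m0 * m)" by linarith
      then show ?thesis by (simp add: algebra_simps)
    qed
    have "\<bar>(e1 - \<beta>_SNR * w) * A1\<bar> \<le> (G1 * L * m\<^sup>2) * m"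
      unfolding abs_mult using c1 A1 by (rule mult_mono) (use G_nn L in auto)
    moreover have "\<bar>(e2 - \<beta>_S) * A2\<bar> \<le> (G2 * L * m) * m\<^sup>2"
      unfolding abs_mult using c2 by (rule mult_mono) (use A2 G_nn L m_nn in auto)
    moreover have "\<bar>(e3 - (\<beta>\<^sup>2 + \<beta>_SNR\<^sup>2 * w\<^sup>2)) * V\<bar> \<le> ((G1\<^sup>2 * L + \<beta>_SNR\<^sup>2 * m0) * m) * m\<^sup>2"
      unfolding abs_mult using c3 V by (rule mult_mono) (use L m_nn in auto)
    moreover have "K3 * m ^ 3 = (G1 * L * m\<^sup>2) * m + (G2 * L * m) * m\<^sup>2 + ((G1\<^sup>2 * L + \<beta>_SNR\<^sup>2 * m0) * m) * m\<^sup>2"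
      by (simp add: K3_def algebra_simps power2_eq_square power3_eq_cube)
    moreover have "(e1 * A1 + e2 * A2 / 2 + e3 * V / 2)
        - (\<beta>_SNR * w * A1 + \<beta>_S * A2 / 2 + (\<beta>\<^sup>2 + \<beta>_SNR\<^sup>2 * w\<^sup>2) * V / 2)
        = (e1 - \<beta>_SNR * w) * A1 + (e2 - \<beta>_S) * A2 / 2 + (e3 - (\<beta>\<^sup>2 + \<beta>_SNR\<^sup>2 * w\<^sup>2)) * V / 2"
      by (simp add: algebra_simps diff_divide_distrib add_divide_distrib)
    ultimately have X3: "\<bar>(e1 * A1 + e2 * A2 / 2 + e3 * V / 2)
        - (\<beta>_SNR * w * A1 + \<beta>_S * A2 / 2 + (\<beta>\<^sup>2 + \<beta>_SNR\<^sup>2 * w\<^sup>2) * V / 2)\<bar> \<le> K3 * m ^ 3"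
      by linarith
    have "P.prob UNIV = 1" "Q.prob UNIV = 1" using P.prob_space Q.prob_space by simp_all
    then have "\<bar>(\<integral>y. \<Phi>1 y \<partial>Pout g0 w) - (\<integral>y. \<Phi>2 y \<partial>std_normal_distribution)\<bar> \<le> K1 * m ^ 3 + K2 * m ^ 3 + K3 * m ^ 3"
      using X1 X2 X3 int_\<kappa> unfolding G by (simp add: K2_def)
    also have "\<dots> = (K1 + K2 + K3) * m ^ 3" by (simp add: distrib_right)
    also have "\<dots> \<le> max 0 (K1 + K2 + K3) * m ^ 3" by (intro mult_right_mono) (use m_nn in auto)
    finally show "\<bar>(\<integral>y. ln (\<integral>x. exp (g y (a x) - g y 0) \<partial>\<mu>) \<partial>Pout g0 w)
        - (\<integral>y. ln (\<integral>x. exp (\<beta> * y * a x + \<beta>_SNR * w * a x + \<beta>_S * (a x)\<^sup>2 / 2) \<partial>\<mu>)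
            \<partial>std_normal_distribution)\<bar> \<le> max 0 (K1 + K2 + K3) * m ^ 3"
      unfolding \<Phi>1_def \<Phi>2_def .
  qed
qed


section \<open>Lindeberg replacement for log-partition functions\<close>

text \<open>
  The factors of the other pairs turn the prior into such a tilted measure, so that replacing the
  energy of one pair only changes the log-moment generating function of that energy.
\<close>

definition tilted :: "'a measure \<Rightarrow> ('a \<Rightarrow> real) \<Rightarrow> 'a measure" where
  "tilted \<nu> U = density \<nu> (\<lambda>x. ennreal (exp (U x) / (\<integral>x. exp (U x) \<partial>\<nu>)))"

lemma sets_tilted [measurable_cong, simp]: "sets (tilted \<nu> U) = sets \<nu>"
  and space_tilted [simp]: "space (tilted \<nu> U) = space \<nu>"
  by (simp_all add: tilted_def)

lemma (in finite_measure)
  fixes U :: "'a \<Rightarrow> real"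
  assumes [measurable]: "U \<in> borel_measurable M" and U: "\<And>x. x \<in> space M \<Longrightarrow> \<bar>U x\<bar> \<le> B"
    and M: "measure M (space M) > 0"
  shows prob_space_tilted: "prob_space (tilted M U)"
    and ln_integral_exp_add: "\<And>(h :: 'a \<Rightarrow> real) B'. h \<in> borel_measurable M \<Longrightarrow> (\<And>x. x \<in> space M \<Longrightarrow> \<bar>h x\<bar> \<le> B') \<Longrightarrow>
      ln (\<integral>x. exp (h x + U x) \<partial>M) = ln (\<integral>x. exp (U x) \<partial>M) + ln (\<integral>x. exp (h x) \<partial>tilted M U)"
proof -
  define Z where "Z = (\<integral>x. exp (U x) \<partial>M)"
  have Z: "Z > 0" unfolding Z_def by (rule log_integral_exp_bound[OF _ U M]) simp_all
  have i: "integrable M (\<lambda>x. exp (U x))"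
    by (rule integrable_bounded[of _ "exp B"]) (use U in \<open>force+\<close>)
  have "emeasure (tilted M U) (space M) = (\<integral>\<^sup>+ x. ennreal (exp (U x) / Z) \<partial>M)"
    unfolding tilted_def Z_def[symmetric] by (subst emeasure_density) (auto intro!: nn_integral_cong)
  also have "\<dots> = ennreal (\<integral>x. exp (U x) / Z \<partial>M)"
    using i Z by (intro nn_integral_eq_integral) auto
  also have "\<dots> = 1" using Z by (simp add: Z_def)
  finally show "prob_space (tilted M U)" by (intro prob_spaceI) simp
  fix h :: "'a \<Rightarrow> real" and B' assume [measurable]: "h \<in> borel_measurable M" and h: "\<And>x. x \<in> space M \<Longrightarrow> \<bar>h x\<bar> \<le> B'"
  have "0 < (\<integral>x. exp (h x + U x) \<partial>M)"
  proof (rule log_integral_exp_bound(1)[OF _ _ M])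
    fix x assume "x \<in> space M"
    then show "\<bar>h x + U x\<bar> \<le> B' + B" using h[of x] U[of x] by linarith
  qed simp
  moreover have "(\<integral>x. exp (h x) \<partial>tilted M U) = (\<integral>x. exp (h x + U x) / Z \<partial>M)"
    unfolding tilted_def Z_def[symmetric] using Z
    by (subst integral_density) (auto simp: exp_add mult.commute)
  ultimately show "ln (\<integral>x. exp (h x + U x) \<partial>M) = ln (\<integral>x. exp (U x) \<partial>M) + ln (\<integral>x. exp (h x) \<partial>tilted M U)"
    using Z by (simp add: Z_def[symmetric] ln_div)
qed

text \<open>Fubini, since (y, Y) \<mapsto> Y(e := y) carries the product of \<open>M e\<close> and
  \<open>PiM J M\<close> to \<open>PiM (insert e J) M\<close>. The coordinate e is integrated first,
  with the others frozen.\<close>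

lemma
  fixes F :: "_ \<Rightarrow> real"
  assumes M: "\<And>i. prob_space (M i)" and "e \<notin> J" and F: "integrable (PiM (insert e J) M) F"
  shows integrable_PiM_insert: "integrable (PiM J M) (\<lambda>Y. \<integral>y. F (Y(e := y)) \<partial>M e)"
    and integral_PiM_insert: "(\<integral>Y. F Y \<partial>PiM (insert e J) M) = (\<integral>Y. (\<integral>y. F (Y(e := y)) \<partial>M e) \<partial>PiM J M)"
proof -
  interpret PJ: prob_space "PiM J M" by (rule prob_space_PiM) (rule M)
  interpret Me: prob_space "M e" by (rule M)
  interpret pair_sigma_finite "M e" "PiM J M" ..
  have d: "distr (M e \<Otimes>\<^sub>M PiM J M) (PiM (insert e J) M) (\<lambda>(y, Y). Y(e := y)) = PiM (insert e J) M"
    by (rule distr_pair_PiM_eq_PiM) (rule M)+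
  have m: "(\<lambda>(y, Y). Y(e := y)) \<in> measurable (M e \<Otimes>\<^sub>M PiM J M) (PiM (insert e J) M)"
    by measurable
  have i: "integrable (M e \<Otimes>\<^sub>M PiM J M) (\<lambda>(y, Y). F (Y(e := y)))"
    using integrable_distr[OF m, of F] F unfolding d by (simp add: split_beta')
  from Bochner_Integration.integrable_cong[THEN iffD1, OF refl refl integrable_snd[OF i]]
  show "integrable (PiM J M) (\<lambda>Y. \<integral>y. F (Y(e := y)) \<partial>M e)" .
  have "(\<integral>Y. F Y \<partial>PiM (insert e J) M) = (\<integral>z. F ((\<lambda>(y, Y). Y(e := y)) z) \<partial>(M e \<Otimes>\<^sub>M PiM J M))"
    using integral_distr[OF m borel_measurable_integrable[OF F]] unfolding d .
  also have "\<dots> = (\<integral>Y. (\<integral>y. F (Y(e := y)) \<partial>M e) \<partial>PiM J M)"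
    using integral_snd[OF i] by (simp add: split_beta')
  finally show "(\<integral>Y. F Y \<partial>PiM (insert e J) M) = (\<integral>Y. (\<integral>y. F (Y(e := y)) \<partial>M e) \<partial>PiM J M)" .
qed

lemma integrable_PiM_component:
  fixes b :: "_ \<Rightarrow> real"
  assumes M: "\<And>i. prob_space (M i)" and "i \<in> I" and b: "integrable (M i) b"
  shows "integrable (PiM I M) (\<lambda>Y. b (Y i))"
proof -
  have "integrable (distr (PiM I M) (M i) (\<lambda>Y. Y i)) b"
    using b distr_PiM_component[of I M i] M \<open>i \<in> I\<close> by simp
  then show ?thesis by (rule integrable_distr[rotated]) (simp add: \<open>i \<in> I\<close>)
qed

text \<open>The bound may depend on y but not on x, and it holds for every y: each frozen energy is
  bounded, so the tilted measure exists for all observations, while integrability of b makes the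
  log-partition function integrable. A constant bound would not do for the Gaussian energies, which
  can grow linearly in the noise.\<close>

definition admissible :: "'x measure \<Rightarrow> real measure \<Rightarrow> (real \<Rightarrow> 'x \<Rightarrow> real) \<Rightarrow> (real \<Rightarrow> real) \<Rightarrow> bool" where
  "admissible \<nu> Q f b \<longleftrightarrow> sets Q = sets borel \<and> case_prod f \<in> borel_measurable (borel \<Otimes>\<^sub>M \<nu>) \<and>
     integrable Q b \<and> (\<forall>y. \<forall>x\<in>space \<nu>. \<bar>f y x\<bar> \<le> b y)"

definition log_partition ::
  "'i set \<Rightarrow> 'x measure \<Rightarrow> ('i \<Rightarrow> real \<Rightarrow> 'x \<Rightarrow> real) \<Rightarrow> ('i \<Rightarrow> real) \<Rightarrow> real" where
  "log_partition I \<nu> f Y = ln (\<integral>x. exp (\<Sum>i\<in>I. f i (Y i) x) \<partial>\<nu>)"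

lemma admissible_section:
  assumes "admissible \<nu> Q f b"
  shows "f y \<in> borel_measurable \<nu>"
proof -
  have "case_prod f \<in> borel_measurable (borel \<Otimes>\<^sub>M \<nu>)" using assms by (simp add: admissible_def)
  from measurable_compose[OF measurable_Pair1' this, of y] show ?thesis by simp
qed

lemma borel_measurable_log_partition:
  assumes "sigma_finite_measure \<nu>" and adm: "\<And>i. i \<in> I \<Longrightarrow> admissible \<nu> (M i) (f i) (b i)"
  shows "log_partition I \<nu> f \<in> borel_measurable (PiM I M)"
proof -
  interpret sigma_finite_measure \<nu> by fact
  have "(\<lambda>p. f i (fst p i) (snd p)) \<in> borel_measurable (PiM I M \<Otimes>\<^sub>M \<nu>)" if i: "i \<in> I" for i
  proof -
    have Mi: "sets (M i) = sets borel" using adm[OF i] by (simp add: admissible_def)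
    have "(\<lambda>p. (fst p i, snd p)) \<in> measurable (PiM I M \<Otimes>\<^sub>M \<nu>) (M i \<Otimes>\<^sub>M \<nu>)"
      by (rule measurable_Pair[OF measurable_compose[OF measurable_fst measurable_component_singleton[OF i]]
            measurable_snd])
    then have "(\<lambda>p. (fst p i, snd p)) \<in> measurable (PiM I M \<Otimes>\<^sub>M \<nu>) (borel \<Otimes>\<^sub>M \<nu>)"
      by (simp only: measurable_cong_sets[OF refl sets_pair_measure_cong[OF Mi refl]])
    from measurable_compose[OF this, of "case_prod (f i)" borel] adm[OF i] show ?thesis
      by (simp add: admissible_def)
  qed
  then have [measurable]: "(\<lambda>p. \<Sum>i\<in>I. f i (fst p i) (snd p)) \<in> borel_measurable (PiM I M \<Otimes>\<^sub>M \<nu>)"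
    by (rule borel_measurable_sum)
  have [measurable]: "(\<lambda>(Y, x). exp (\<Sum>i\<in>I. f i (Y i) x)) \<in> borel_measurable (PiM I M \<Otimes>\<^sub>M \<nu>)"
    unfolding split_beta' by measurable
  show ?thesis unfolding log_partition_def by measurable
qed

lemma log_partition_bound:
  assumes "finite_measure \<nu>" and pos: "measure \<nu> (space \<nu>) > 0"
    and adm: "\<And>i. i \<in> I \<Longrightarrow> admissible \<nu> (M i) (f i) (b i)"
  shows "\<bar>log_partition I \<nu> f Y - ln (measure \<nu> (space \<nu>))\<bar> \<le> (\<Sum>i\<in>I. b i (Y i))"
proof -
  interpret finite_measure \<nu> by fact
  note [measurable] = admissible_section[OF adm]
  show ?thesis unfolding log_partition_def
  proof (rule log_integral_exp_bound(2)[OF _ _ pos])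
    fix x assume x: "x \<in> space \<nu>"
    show "\<bar>\<Sum>i\<in>I. f i (Y i) x\<bar> \<le> (\<Sum>i\<in>I. b i (Y i))"
      by (intro order.trans[OF sum_abs] sum_mono) (use adm x in \<open>auto simp: admissible_def\<close>)
  qed measurable
qed

lemma integrable_log_partition:
  assumes \<nu>: "finite_measure \<nu>" and pos: "measure \<nu> (space \<nu>) > 0" and M: "\<And>i. prob_space (M i)"
    and adm: "\<And>i. i \<in> I \<Longrightarrow> admissible \<nu> (M i) (f i) (b i)"
  shows "integrable (PiM I M) (log_partition I \<nu> f)"
proof (rule Bochner_Integration.integrable_bound)
  interpret finite_measure \<nu> by fact
  interpret prob_space "PiM I M" by (rule prob_space_PiM) (rule M)
  show "integrable (PiM I M) (\<lambda>Y. \<bar>ln (measure \<nu> (space \<nu>))\<bar> + (\<Sum>i\<in>I. b i (Y i)))"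
    by (intro Bochner_Integration.integrable_add Bochner_Integration.integrable_sum
        integrable_PiM_component M integrable_const) (use adm in \<open>auto simp: admissible_def\<close>)
  show "log_partition I \<nu> f \<in> borel_measurable (PiM I M)"
    by (rule borel_measurable_log_partition[OF _ adm]) unfold_locales
  show "AE Y in PiM I M. norm (log_partition I \<nu> f Y)
      \<le> norm (\<bar>ln (measure \<nu> (space \<nu>))\<bar> + (\<Sum>i\<in>I. b i (Y i)))"
  proof (rule AE_I2)
    fix Y
    show "norm (log_partition I \<nu> f Y) \<le> norm (\<bar>ln (measure \<nu> (space \<nu>))\<bar> + (\<Sum>i\<in>I. b i (Y i)))"
      using log_partition_bound[where I = I and M = M and f = f and b = b and Y = Y, OF \<nu> pos adm]
      by simp
  qed
qed

text \<open>\<open>U Y\<close> sums over J only and ignores the coordinate e, so the tilted measure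
  stays fixed while y is integrated. The term \<open>log_partition J \<nu> f Y\<close> is free of
  the pair e and will cancel between two models that differ in that pair alone.\<close>

lemma log_partition_insert:
  assumes \<nu>: "finite_measure \<nu>" and pos: "measure \<nu> (space \<nu>) > 0"
    and J: "finite J" "e \<notin> J" and M: "\<And>i. prob_space (M i)"
    and adm: "\<And>i. i \<in> insert e J \<Longrightarrow> admissible \<nu> (M i) (f i) (b i)"
  defines "U \<equiv> \<lambda>Y x. \<Sum>i\<in>J. f i (Y i) x"
  shows "prob_space (tilted \<nu> (U Y))"
    and "(\<integral>y. log_partition (insert e J) \<nu> f (Y(e := y)) \<partial>M e)
      = log_partition J \<nu> f Y + (\<integral>y. ln (\<integral>x. exp (f e y x) \<partial>tilted \<nu> (U Y)) \<partial>M e)"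
proof -
  interpret finite_measure \<nu> by fact
  interpret Me: prob_space "M e" by (rule M)
  have Um [measurable]: "U Y \<in> borel_measurable \<nu>"
    unfolding U_def using admissible_section[OF adm] by measurable
  have Ub: "\<bar>U Y x\<bar> \<le> (\<Sum>i\<in>J. b i (Y i))" if "x \<in> space \<nu>" for x
    unfolding U_def by (intro order.trans[OF sum_abs] sum_mono) (use adm that in \<open>auto simp: admissible_def\<close>)
  show P: "prob_space (tilted \<nu> (U Y))" by (rule prob_space_tilted[OF _ Ub pos]) simp_all
  interpret T: prob_space "tilted \<nu> (U Y)" by (rule P)
  note e = adm[of e, simplified]
  have Te: "admissible (tilted \<nu> (U Y)) (M e) (f e) (b e)"
    using e by (simp add: admissible_def measurable_cong_sets[OF sets_pair_measure_cong[OF refl sets_tilted] refl])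
  have eq: "log_partition (insert e J) \<nu> f (Y(e := y))
      = log_partition J \<nu> f Y + ln (\<integral>x. exp (f e y x) \<partial>tilted \<nu> (U Y))" for y
  proof -
    have "(\<Sum>i\<in>insert e J. f i ((Y(e := y)) i) x) = f e y x + U Y x" for x
      using J by (simp add: U_def) (intro sum.cong, auto)
    then show ?thesis
      unfolding log_partition_def
      using ln_integral_exp_add[OF Um Ub pos, of "f e y" "b e y"] admissible_section[OF e] e
      by (simp add: admissible_def U_def)
  qed
  have "integrable (M e) (\<lambda>y. ln (\<integral>x. exp (f e y x) \<partial>tilted \<nu> (U Y)))"
  proof (rule Bochner_Integration.integrable_bound)
    show "integrable (M e) (b e)" using e by (simp add: admissible_def)
    have [measurable_cong]: "sets (M e) = sets borel"
      and [measurable]: "case_prod (f e) \<in> borel_measurable (borel \<Otimes>\<^sub>M tilted \<nu> (U Y))"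
      using Te by (simp_all add: admissible_def)
    show "(\<lambda>y. ln (\<integral>x. exp (f e y x) \<partial>tilted \<nu> (U Y))) \<in> borel_measurable (M e)" by measurable
    show "AE y in M e. norm (ln (\<integral>x. exp (f e y x) \<partial>tilted \<nu> (U Y))) \<le> norm (b e y)"
    proof (rule AE_I2)
      fix y
      show "norm (ln (\<integral>x. exp (f e y x) \<partial>tilted \<nu> (U Y))) \<le> norm (b e y)"
        using T.log_integral_exp_bound(2)[of "f e y" "b e y"] admissible_section[OF Te] Te T.prob_space
        by (force simp: admissible_def)
    qed
  qed
  then show "(\<integral>y. log_partition (insert e J) \<nu> f (Y(e := y)) \<partial>M e)
      = log_partition J \<nu> f Y + (\<integral>y. ln (\<integral>x. exp (f e y x) \<partial>tilted \<nu> (U Y)) \<partial>M e)"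
    unfolding eq by (simp add: Me.prob_space)
qed

lemma log_partition_swap_one:
  fixes f :: "'i \<Rightarrow> real \<Rightarrow> 'x \<Rightarrow> real"
  assumes \<nu>: "finite_measure \<nu>" and pos: "measure \<nu> (space \<nu>) > 0"
    and J: "finite J" "e \<notin> J" and M: "\<And>i. prob_space (M i)" "\<And>i. prob_space (M' i)"
    and adm: "\<And>i. i \<in> insert e J \<Longrightarrow> admissible \<nu> (M i) (f i) (b i)"
      "\<And>i. i \<in> insert e J \<Longrightarrow> admissible \<nu> (M' i) (f' i) (b' i)"
    and eq: "\<And>i. i \<in> J \<Longrightarrow> M' i = M i" "\<And>i. i \<in> J \<Longrightarrow> f' i = f i"
    and step: "\<And>\<mu>. prob_space \<mu> \<Longrightarrow> sets \<mu> = sets \<nu> \<Longrightarrow>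
      \<bar>(\<integral>y. ln (\<integral>x. exp (f e y x) \<partial>\<mu>) \<partial>M e) - (\<integral>y. ln (\<integral>x. exp (f' e y x) \<partial>\<mu>) \<partial>M' e)\<bar> \<le> c"
  shows "\<bar>(\<integral>Y. log_partition (insert e J) \<nu> f Y \<partial>PiM (insert e J) M)
    - (\<integral>Y. log_partition (insert e J) \<nu> f' Y \<partial>PiM (insert e J) M')\<bar> \<le> c"
proof -
  let ?F = "\<lambda>Y. \<integral>y. log_partition (insert e J) \<nu> f (Y(e := y)) \<partial>M e"
  let ?F' = "\<lambda>Y. \<integral>y. log_partition (insert e J) \<nu> f' (Y(e := y)) \<partial>M' e"
  have PJ: "PiM J M' = PiM J M" by (rule PiM_cong) (simp_all add: eq)
  interpret prob_space "PiM J M" by (rule prob_space_PiM) (rule M)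
  note i = integrable_log_partition[where M = M and f = f, OF \<nu> pos M(1) adm(1)]
  note i' = integrable_log_partition[where M = M' and f = f', OF \<nu> pos M(2) adm(2)]
  note iF = integrable_PiM_insert[where M = M, OF M(1) J(2) i] and iF' = integrable_PiM_insert[where M = M', OF M(2) J(2) i', unfolded PJ]
  have "(\<integral>Y. log_partition (insert e J) \<nu> f Y \<partial>PiM (insert e J) M)
      - (\<integral>Y. log_partition (insert e J) \<nu> f' Y \<partial>PiM (insert e J) M') = (\<integral>Y. ?F Y - ?F' Y \<partial>PiM J M)"
    using integral_PiM_insert[where M = M, OF M(1) J(2) i] integral_PiM_insert[where M = M', OF M(2) J(2) i', unfolded PJ] iF iF'
    by simp
  also have "\<bar>\<dots>\<bar> \<le> c"
  proof (intro order.trans[OF integral_abs_bound] integral_le_const AE_I2)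
    show "integrable (PiM J M) (\<lambda>Y. \<bar>?F Y - ?F' Y\<bar>)" using iF iF' by simp
    fix Y
    let ?\<mu> = "tilted \<nu> (\<lambda>x. \<Sum>i\<in>J. f i (Y i) x)"
    have "log_partition J \<nu> f' Y = log_partition J \<nu> f Y"
      "(\<lambda>x. \<Sum>i\<in>J. f' i (Y i) x) = (\<lambda>x. \<Sum>i\<in>J. f i (Y i) x)"
      by (simp_all add: log_partition_def eq)
    then show "\<bar>?F Y - ?F' Y\<bar> \<le> c"
      using log_partition_insert(2)[where M = M and f = f and Y = Y, OF \<nu> pos J M(1) adm(1)]
        log_partition_insert(2)[where M = M' and f = f' and Y = Y, OF \<nu> pos J M(2) adm(2)]
        step[OF log_partition_insert(1)[where M = M and f = f and Y = Y, OF \<nu> pos J M(1) adm(1)] sets_tilted]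
      by simp
  qed
  finally show ?thesis .
qed

text \<open>Telescoping over hybrid models. \<open>step\<close> is demanded for every probability
  measure on the space of \<nu>, because the tilted measure depends on the observations and on the
  pairs already exchanged.\<close>

lemma log_partition_Lindeberg:
  fixes f :: "'i \<Rightarrow> real \<Rightarrow> 'x \<Rightarrow> real" and c :: real
  assumes \<nu>: "finite_measure \<nu>" and pos: "measure \<nu> (space \<nu>) > 0"
    and I: "finite I" and M: "\<And>i. prob_space (M i)" "\<And>i. prob_space (M' i)"
    and adm: "\<And>i. i \<in> I \<Longrightarrow> admissible \<nu> (M i) (f i) (b i)"
      "\<And>i. i \<in> I \<Longrightarrow> admissible \<nu> (M' i) (f' i) (b' i)"
    and step: "\<And>\<mu> i. i \<in> I \<Longrightarrow> prob_space \<mu> \<Longrightarrow> sets \<mu> = sets \<nu> \<Longrightarrow>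
      \<bar>(\<integral>y. ln (\<integral>x. exp (f i y x) \<partial>\<mu>) \<partial>M i) - (\<integral>y. ln (\<integral>x. exp (f' i y x) \<partial>\<mu>) \<partial>M' i)\<bar> \<le> c"
  shows "\<bar>(\<integral>Y. log_partition I \<nu> f Y \<partial>PiM I M) - (\<integral>Y. log_partition I \<nu> f' Y \<partial>PiM I M')\<bar> \<le> card I * c"
proof -
  \<comment> \<open>Hybrid models: primed laws, energies and bounds on S, unprimed ones elsewhere. S
    = {} and S = I are the two ends.\<close>
  define MS where "MS S i = (if i \<in> S then M' i else M i)" for S i
  define fS where "fS S i = (if i \<in> S then f' i else f i)" for S i
  define bS where "bS S i = (if i \<in> S then b' i else b i)" for S i
  have MS: "prob_space (MS S i)" for S i using M by (simp add: MS_def)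
  have admS: "admissible \<nu> (MS S i) (fS S i) (bS S i)" if "i \<in> I" for S i
    using adm[OF that] by (simp add: MS_def fS_def bS_def)
  define \<Phi> where "\<Phi> S = (\<integral>Y. log_partition I \<nu> (fS S) Y \<partial>PiM I (MS S))" for S
  have "\<bar>\<Phi> {} - \<Phi> S\<bar> \<le> card S * c" if "S \<subseteq> I" for S
    using finite_subset[OF that I] that
  proof (induction S rule: finite_induct)
    case (insert e S)
    \<comment> \<open>Every index other than e, exchanged or not, is frozen.\<close>
    have I': "I = insert e (I - {e})" using insert.prems by auto
    have "\<bar>\<Phi> S - \<Phi> (insert e S)\<bar> \<le> c"
      unfolding \<Phi>_def
    proof (subst (1 2 3 4) I', rule log_partition_swap_one[OF \<nu> pos _ _ MS MS, where b = "bS S" and b' = "bS (insert e S)"])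
      fix \<mu> :: "'x measure" assume "prob_space \<mu>" "sets \<mu> = sets \<nu>"
      then show "\<bar>(\<integral>y. ln (\<integral>x. exp (fS S e y x) \<partial>\<mu>) \<partial>MS S e)
          - (\<integral>y. ln (\<integral>x. exp (fS (insert e S) e y x) \<partial>\<mu>) \<partial>MS (insert e S) e)\<bar> \<le> c"
        using step[of e \<mu>] insert by (simp add: MS_def fS_def)
    next
      fix i assume "i \<in> I - {e}"
      then show "MS (insert e S) i = MS S i" "fS (insert e S) i = fS S i" by (auto simp: MS_def fS_def)
    qed (use I admS insert.prems in auto)
    then show ?case using insert by (simp add: distrib_right)
  qed simp
  from this[of I] have "\<bar>\<Phi> {} - \<Phi> I\<bar> \<le> card I * c" by simp
  moreover have "\<Phi> {} = (\<integral>Y. log_partition I \<nu> f Y \<partial>PiM I M)"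
    by (simp add: \<Phi>_def MS_def[abs_def] fS_def[abs_def])
  moreover have "\<Phi> I = (\<integral>Y. log_partition I \<nu> f' Y \<partial>PiM I M')"
  proof -
    have "PiM I (MS I) = PiM I M'" by (rule PiM_cong) (auto simp: MS_def)
    moreover have "log_partition I \<nu> (fS I) = log_partition I \<nu> f'"
      by (simp add: log_partition_def fun_eq_iff fS_def)
    ultimately show ?thesis by (simp add: \<Phi>_def)
  qed
  ultimately show ?thesis by simp
qed


section \<open>Extended expectations and disintegration\<close>

text \<open>Integrability makes the positive and the negative part finite, so the undefined
  difference \<infinity> - \<infinity> does not occur.\<close>

lemma eexpectation_eq_integral:
  assumes h: "integrable M h" and eq: "AE x in M. f x = ereal (h x)"
  shows "eexpectation M f = ereal (integral\<^sup>L M h)"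
proof -
  have "(\<integral>\<^sup>+ x. e2ennreal (f x) \<partial>M) = (\<integral>\<^sup>+ x. ennreal (h x) \<partial>M)"
    by (rule nn_integral_cong_AE) (use eq in eventually_elim, simp)
  moreover have "(\<integral>\<^sup>+ x. e2ennreal (- f x) \<partial>M) = (\<integral>\<^sup>+ x. ennreal (- h x) \<partial>M)"
    by (rule nn_integral_cong_AE) (use eq in eventually_elim, simp)
  moreover have "(\<integral>\<^sup>+ x. ennreal (h x) \<partial>M) \<noteq> \<infinity>" "(\<integral>\<^sup>+ x. ennreal (- h x) \<partial>M) \<noteq> \<infinity>"
    using h unfolding real_integrable_def by auto
  ultimately show ?thesis
    unfolding eexpectation_def real_lebesgue_integral_def[OF h]
    by (cases "\<integral>\<^sup>+ x. ennreal (h x) \<partial>M"; cases "\<integral>\<^sup>+ x. ennreal (- h x) \<partial>M") auto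
qed

lemma elog_ennreal: "z > 0 \<Longrightarrow> elog (ennreal z) = ereal (ln z)"
  by (simp add: elog_def)

text \<open>The constant c leaves room for the sum of the \<open>g (Y e) 0\<close>, which factors
  out of the partition function and can be of any size.\<close>

lemma (in finite_measure) elog_nn_integral_exp:
  assumes [measurable]: "F \<in> borel_measurable M" and F: "\<And>x. x \<in> space M \<Longrightarrow> \<bar>F x\<bar> \<le> B"
    and pos: "measure M (space M) > 0"
  shows "elog (\<integral>\<^sup>+ x. ennreal (exp (c + F x)) \<partial>M) = ereal (c + ln (\<integral>x. exp (F x) \<partial>M))"
proof -
  have i: "integrable M (\<lambda>x. exp (F x))"
    by (rule integrable_bounded[of _ "exp B"]) (use F in \<open>force+\<close>)
  have Z: "0 < (\<integral>x. exp (F x) \<partial>M)" by (rule log_integral_exp_bound(1)[OF _ F pos]) simp_all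
  have "(\<integral>\<^sup>+ x. ennreal (exp (c + F x)) \<partial>M) = ennreal (\<integral>x. exp c * exp (F x) \<partial>M)"
    unfolding exp_add using i by (intro nn_integral_eq_integral) auto
  also have "\<dots> = ennreal (exp c * (\<integral>x. exp (F x) \<partial>M))" by simp
  finally show ?thesis using Z by (simp add: elog_ennreal ln_mult)
qed

text \<open>The joint law of signal and observations is a mixture, not a product. Fubini is replaced
  by the disintegration of nonnegative integrals, applied to the positive and the negative part of
  h.\<close>

lemma
  fixes h :: "'a \<times> 'b \<Rightarrow> real"
  assumes dm: "\<And>f. f \<in> borel_measurable J \<Longrightarrow> (\<lambda>x. \<integral>\<^sup>+ y. f (x, y) \<partial>K x) \<in> borel_measurable M"
    and di: "\<And>f. f \<in> borel_measurable J \<Longrightarrow> (\<integral>\<^sup>+ z. f z \<partial>J) = (\<integral>\<^sup>+ x. \<integral>\<^sup>+ y. f (x, y) \<partial>K x \<partial>M)"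
    and sec: "\<And>x. x \<in> space M \<Longrightarrow> (\<lambda>y. h (x, y)) \<in> borel_measurable (K x)"
    and h: "integrable J h"
  shows integrable_disintegration: "integrable M (\<lambda>x. \<integral>y. h (x, y) \<partial>K x)"
    and integral_disintegration: "(\<integral>z. h z \<partial>J) = (\<integral>x. (\<integral>y. h (x, y) \<partial>K x) \<partial>M)"
proof -
  have hm [measurable]: "h \<in> borel_measurable J" using h by (rule borel_measurable_integrable)
  define a where "a x = (\<integral>\<^sup>+ y. ennreal (h (x, y)) \<partial>K x)" for x
  define b where "b x = (\<integral>\<^sup>+ y. ennreal (- h (x, y)) \<partial>K x)" for x
  have [measurable]: "a \<in> borel_measurable M" "b \<in> borel_measurable M"
    unfolding a_def[abs_def] b_def[abs_def]
    by (rule dm[of "\<lambda>z. ennreal (h z)"], simp) (rule dm[of "\<lambda>z. ennreal (- h z)"], simp)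
  have ab: "(\<integral>\<^sup>+ z. ennreal (h z) \<partial>J) = (\<integral>\<^sup>+ x. a x \<partial>M)" "(\<integral>\<^sup>+ z. ennreal (- h z) \<partial>J) = (\<integral>\<^sup>+ x. b x \<partial>M)"
    unfolding a_def b_def by (rule di; simp)+
  have fin: "(\<integral>\<^sup>+ x. a x \<partial>M) < \<infinity>" "(\<integral>\<^sup>+ x. b x \<partial>M) < \<infinity>"
    using h unfolding real_integrable_def ab by (auto simp: less_top)
  have AEfin: "AE x in M. a x \<noteq> \<infinity>" "AE x in M. b x \<noteq> \<infinity>"
    by (rule nn_integral_PInf_AE; use fin in simp)+
  \<comment> \<open>Where a part is infinite the Bochner integral has the default value 0. The
    explicit form gives measurability in x, and such x form a null set.\<close>
  have \<kappa>: "(\<integral>y. h (x, y) \<partial>K x) = (if a x \<noteq> \<infinity> \<and> b x \<noteq> \<infinity> then enn2real (a x) - enn2real (b x) else 0)"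
    if "x \<in> space M" for x
  proof -
    have "integrable (K x) (\<lambda>y. h (x, y)) \<longleftrightarrow> a x \<noteq> \<infinity> \<and> b x \<noteq> \<infinity>"
      using sec[OF that] by (simp add: real_integrable_def a_def b_def)
    then show ?thesis
      by (auto simp: real_lebesgue_integral_def a_def b_def not_integrable_integral_eq)
  qed
  have m: "(\<lambda>x. \<integral>y. h (x, y) \<partial>K x) \<in> borel_measurable M"
    by (subst measurable_cong[OF \<kappa>]) measurable
  have e: "(\<integral>\<^sup>+ x. ennreal (enn2real (a x)) \<partial>M) = (\<integral>\<^sup>+ x. a x \<partial>M)"
    "(\<integral>\<^sup>+ x. ennreal (enn2real (b x)) \<partial>M) = (\<integral>\<^sup>+ x. b x \<partial>M)"
    by (rule nn_integral_cong_AE, use AEfin(1) in eventually_elim, simp add: less_top)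
      (rule nn_integral_cong_AE, use AEfin(2) in eventually_elim, simp add: less_top)
  have i: "integrable M (\<lambda>x. enn2real (a x))" "integrable M (\<lambda>x. enn2real (b x))"
    using fin e by (auto intro!: integrableI_nonneg)
  have AE\<kappa>: "AE x in M. (\<integral>y. h (x, y) \<partial>K x) = enn2real (a x) - enn2real (b x)"
    using AEfin AE_space by eventually_elim (simp add: \<kappa>)
  show "integrable M (\<lambda>x. \<integral>y. h (x, y) \<partial>K x)"
    using Bochner_Integration.integrable_diff[OF i] AE\<kappa> m by (subst integrable_cong_AE[OF m _ AE\<kappa>]) auto
  have "(\<integral>x. (\<integral>y. h (x, y) \<partial>K x) \<partial>M) = (\<integral>x. enn2real (a x) - enn2real (b x) \<partial>M)"
    by (rule integral_cong_AE[OF m _ AE\<kappa>]) measurable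
  also have "\<dots> = (\<integral>x. enn2real (a x) \<partial>M) - (\<integral>x. enn2real (b x) \<partial>M)"
    using i by simp
  also have "\<dots> = enn2real (\<integral>\<^sup>+ x. a x \<partial>M) - enn2real (\<integral>\<^sup>+ x. b x \<partial>M)"
    using i by (subst (1 2) integral_eq_nn_integral) (simp_all add: e)
  finally show "(\<integral>z. h z \<partial>J) = (\<integral>x. (\<integral>y. h (x, y) \<partial>K x) \<partial>M)"
    unfolding real_lebesgue_integral_def[OF h] ab by simp
qed

text \<open>Each observation law has total mass 1, so integrating out Y leaves the signal law. This
  carries statements about almost every x0 to almost every (x0, Y).\<close>

lemma distr_inference_law_fst:
  assumes g0: "case_prod g0 \<in> borel_measurable (borel \<Otimes>\<^sub>M borel)"
    and prob: "\<And>w. prob_space (Pout g0 w)"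
    and P0: "prob_space P0" "sets P0 = sets borel"
  shows "distr (inference_law g0 P0 N) (conf_space N) fst = PiM {..<N} (\<lambda>_. P0)"
proof (rule measure_eqI)
  have sP: "sets (PiM {..<N} (\<lambda>_. P0)) = sets (conf_space N)"
    by (rule sets_PiM_cong) (auto simp: P0)
  note [measurable_cong] = sets_inference_law[OF g0 prob P0, of N]
  have fst: "fst \<in> measurable (inference_law g0 P0 N) (conf_space N)" by measurable
  show "sets (distr (inference_law g0 P0 N) (conf_space N) fst) = sets (PiM {..<N} (\<lambda>_. P0))"
    using sP by simp
  fix B assume "B \<in> sets (distr (inference_law g0 P0 N) (conf_space N) fst)"
  then have B [measurable]: "B \<in> sets (conf_space N)" by simp
  have "emeasure (distr (inference_law g0 P0 N) (conf_space N) fst) B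
      = (\<integral>\<^sup>+ z. indicator B (fst z) \<partial>inference_law g0 P0 N)"
    using nn_integral_distr[OF fst, of "indicator B"] by simp
  also have "\<dots> = (\<integral>\<^sup>+ x0. \<integral>\<^sup>+ Y. indicator B x0 \<partial>obs_law g0 N x0 \<partial>PiM {..<N} (\<lambda>_. P0))"
    by (subst nn_integral_inference_law[OF g0 prob P0]) (simp_all, measurable)
  also have "\<dots> = (\<integral>\<^sup>+ x0. indicator B x0 \<partial>PiM {..<N} (\<lambda>_. P0))"
    by (intro nn_integral_cong) (simp add: prob_space.emeasure_space_1[OF prob_space_obs_law[OF prob]])
  also have "\<dots> = emeasure (PiM {..<N} (\<lambda>_. P0)) B" using sP B by simp
  finally show "emeasure (distr (inference_law g0 P0 N) (conf_space N) fst) B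
      = emeasure (PiM {..<N} (\<lambda>_. P0)) B" .
qed


section \<open>The two models with clipped spins\<close>

text \<open>
  Clipping changes \<open>x\<close> and \<open>x\<^sup>0\<close> only on null sets, and makes the bounds on the energies hold
  everywhere instead of almost everywhere.
\<close>

definition clip :: "real \<Rightarrow> real \<Rightarrow> real" where
  "clip C x = max (- C) (min C x)"

lemma abs_clip_le: "0 \<le> C \<Longrightarrow> \<bar>clip C x\<bar> \<le> C"
  by (simp add: clip_def)

lemma clip_eq: "\<bar>x\<bar> \<le> C \<Longrightarrow> clip C x = x"
  by (simp add: clip_def)

lemma borel_measurable_clip [measurable]: "clip C \<in> borel_measurable borel"
  unfolding clip_def[abs_def] by measurable

definition edge :: "real \<Rightarrow> nat \<Rightarrow> (nat \<Rightarrow> real) \<Rightarrow> nat \<times> nat \<Rightarrow> real" where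
  "edge C N x e = clip C (x (fst e)) * clip C (x (snd e)) / sqrt (real N)"

lemma abs_edge_le: "0 \<le> C \<Longrightarrow> \<bar>edge C N x e\<bar> \<le> C\<^sup>2 / sqrt (real N)"
  unfolding edge_def power2_eq_square abs_divide abs_mult
  by (simp add: divide_right_mono mult_mono abs_clip_le)

lemma edge_eq:
  "\<forall>i<N. \<bar>x i\<bar> \<le> C \<Longrightarrow> e \<in> pairs N \<Longrightarrow> edge C N x e = x (fst e) * x (snd e) / sqrt (real N)"
  by (auto simp: edge_def pairs_def clip_eq)

lemma borel_measurable_edge:
  assumes "e \<in> pairs N"
  shows "(\<lambda>x. edge C N x e) \<in> borel_measurable (conf_space N)"
proof -
  have "fst e \<in> {..<N}" "snd e \<in> {..<N}" using assms by (auto simp: pairs_def)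
  then have [measurable]: "(\<lambda>x. x (fst e)) \<in> borel_measurable (conf_space N)"
    "(\<lambda>x. x (snd e)) \<in> borel_measurable (conf_space N)"
    by (auto intro: measurable_component_singleton)
  show ?thesis unfolding edge_def by measurable
qed

lemma AE_PiM_box:
  fixes P :: "real measure" and N :: nat
  assumes P: "prob_space P" "sets P = sets borel" "measure P {-C..C} = 1"
  shows "AE x in PiM {..<N} (\<lambda>_. P). \<forall>i<N. \<bar>x i\<bar> \<le> C"
proof -
  interpret prob_space P by fact
  have "AE x in P. x \<in> {-C..C}" using P by (intro AE_prob_1) simp
  then have "AE x in P. \<bar>x\<bar> \<le> C" by eventually_elim (simp add: abs_le_iff)
  then have "\<forall>i\<in>{..<N}. AE x in PiM {..<N} (\<lambda>_. P). \<bar>x i\<bar> \<le> C"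
    using P by (auto intro!: AE_PiM_component[where P = "\<lambda>x. \<bar>x\<bar> \<le> C"])
  then have "AE x in PiM {..<N} (\<lambda>_. P). \<forall>i\<in>{..<N}. \<bar>x i\<bar> \<le> C"
    by (intro AE_finite_allI) auto
  then show ?thesis by eventually_elim simp
qed

text \<open>\<open>g y 0\<close> can be unbounded in y, whereas the increment is bounded uniformly
  in y over the range of the edge variable. The subtracted terms are those in the definition of the
  free energy.\<close>

definition inference_energy ::
  "(real \<Rightarrow> real \<Rightarrow> real) \<Rightarrow> real \<Rightarrow> nat \<Rightarrow> nat \<times> nat \<Rightarrow> real \<Rightarrow> (nat \<Rightarrow> real) \<Rightarrow> real" where
  "inference_energy g C N e y x = g y (edge C N x e) - g y 0"

text \<open>One pair of the Hamiltonian in edge variables, which absorb the powers of N;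
  \<open>edge C N x0 e\<close> plays the role of w.\<close>

definition gauss_energy ::
  "real \<Rightarrow> real \<Rightarrow> real \<Rightarrow> real \<Rightarrow> nat \<Rightarrow> (nat \<Rightarrow> real) \<Rightarrow> nat \<times> nat \<Rightarrow> real \<Rightarrow> (nat \<Rightarrow> real) \<Rightarrow> real" where
  "gauss_energy \<beta> \<beta>_SNR \<beta>_S C N x0 e y x =
     \<beta> * y * edge C N x e + \<beta>_SNR * edge C N x0 e * edge C N x e + \<beta>_S * (edge C N x e)\<^sup>2 / 2"

text \<open>Only measurability, normalisation and supports are fixed here; the analytic hypotheses
  enter later, through a bound on the increments of g and the estimate for one pair.\<close>

locale inference_problem =
  fixes g g0 :: "real \<Rightarrow> real \<Rightarrow> real" and P0 PX :: "real measure" and C :: real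
    and A :: "nat \<Rightarrow> (nat \<Rightarrow> real) \<Rightarrow> (nat \<Rightarrow> real) set"
  assumes P0: "prob_space P0" "sets P0 = sets borel" "measure P0 {-C..C} = 1"
    and PX: "prob_space PX" "sets PX = sets borel" "measure PX {-C..C} = 1"
    and g_meas: "case_prod g \<in> borel_measurable (borel \<Otimes>\<^sub>M borel)"
    and g0_meas: "case_prod g0 \<in> borel_measurable (borel \<Otimes>\<^sub>M borel)"
    and channel: "\<And>w. prob_space (Pout g0 w)"
    and A: "measurable_set_family A"
begin

abbreviation "signal_law N \<equiv> PiM {..<N} (\<lambda>_. P0)"
abbreviation "prior N \<equiv> PiM {..<N} (\<lambda>_. PX)"
abbreviation "noise_law N \<equiv> PiM (pairs N) (\<lambda>_. std_normal_distribution)"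

lemma C_nonneg: "0 \<le> C"
proof (rule ccontr)
  assume "\<not> 0 \<le> C"
  then have "{-C..C} = {}" by auto
  with PX(3) show False by simp
qed

lemma sets_signal_law [measurable_cong]: "sets (signal_law N) = sets (conf_space N)"
  by (rule sets_PiM_cong) (auto simp: P0)

lemma sets_prior [measurable_cong]: "sets (prior N) = sets (conf_space N)"
  by (rule sets_PiM_cong) (auto simp: PX)

lemma sets_noise_law [measurable_cong]: "sets (noise_law N) = sets (obs_space N)"
  by (rule sets_PiM_cong) auto

lemma space_signal_law: "space (signal_law N) = space (conf_space N)"
  by (rule sets_eq_imp_space_eq) (rule sets_signal_law)

lemma prob_space_prior: "prob_space (prior N)"
  by (rule prob_space_PiM) (rule PX)

lemma prob_space_signal_law: "prob_space (signal_law N)"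
  by (rule prob_space_PiM) (rule P0)

lemma prob_space_noise_law: "prob_space (noise_law N)"
  by (rule prob_space_PiM) (rule prob_space_std_normal)

section \<open>The sets A and the prior restricted to them\<close>

lemma A_graph: "(SIGMA x0:space (conf_space N). A N x0) \<in> sets (conf_space N \<Otimes>\<^sub>M conf_space N)"
  using A by (simp add: measurable_set_family_def)

lemma A_section:
  assumes "x0 \<in> space (conf_space N)"
  shows "A N x0 \<in> sets (conf_space N)"
proof -
  have "A N x0 = Pair x0 -` (SIGMA x0:space (conf_space N). A N x0)" using assms by auto
  then show ?thesis using sets_Pair1[OF A_graph] by simp
qed

definition "mass N x0 = measure (prior N) (A N x0)"

lemma mass_measurable: "mass N \<in> borel_measurable (conf_space N)"
proof -
  interpret prob_space "prior N" by (rule prob_space_prior)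
  let ?S = "SIGMA x0:space (conf_space N). A N x0"
  have "?S \<in> sets (conf_space N \<Otimes>\<^sub>M prior N)"
    using A_graph by (simp add: sets_pair_measure_cong[OF refl sets_prior])
  from measurable_emeasure_Pair[OF this]
  have "(\<lambda>x0. enn2real (emeasure (prior N) (Pair x0 -` ?S))) \<in> borel_measurable (conf_space N)"
    by measurable
  then show ?thesis
    unfolding mass_def[abs_def] measure_def
    by (rule measurable_cong[THEN iffD1, rotated]) (auto intro!: arg_cong[where f = "\<lambda>X. enn2real (emeasure _ X)"])
qed

text \<open>Not normalised, so that it makes sense also when \<open>A N x0\<close> is null; its
  total mass is \<open>mass N x0\<close>.\<close>

definition "restricted N x0 = density (prior N) (\<lambda>x. ennreal (indicator (A N x0) x))"

lemma sets_restricted: "sets (restricted N x0) = sets (conf_space N)"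
  by (simp add: restricted_def sets_prior)

lemma
  assumes x0: "x0 \<in> space (conf_space N)"
  shows finite_measure_restricted: "finite_measure (restricted N x0)"
    and measure_restricted: "measure (restricted N x0) (space (restricted N x0)) = mass N x0"
proof -
  interpret prob_space "prior N" by (rule prob_space_prior)
  have [measurable]: "A N x0 \<in> sets (prior N)" using A_section[OF x0] by (simp add: sets_prior)
  have "emeasure (restricted N x0) (space (restricted N x0)) = (\<integral>\<^sup>+ x. indicator (A N x0) x \<partial>prior N)"
    unfolding restricted_def
    by (subst emeasure_density) (auto intro!: nn_integral_cong simp: ennreal_indicator)
  then have *: "emeasure (restricted N x0) (space (restricted N x0)) = emeasure (prior N) (A N x0)"
    by simp
  then show "finite_measure (restricted N x0)" by (intro finite_measureI) simp
  from * show "measure (restricted N x0) (space (restricted N x0)) = mass N x0"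
    by (simp add: measure_def mass_def)
qed

lemma nn_integral_restricted:
  assumes x0: "x0 \<in> space (conf_space N)" and [measurable]: "F \<in> borel_measurable (conf_space N)"
  shows "(\<integral>\<^sup>+ x. F x \<partial>restricted N x0) = (\<integral>\<^sup>+ x. indicator (A N x0) x * F x \<partial>prior N)"
proof -
  have [measurable]: "A N x0 \<in> sets (prior N)" using A_section[OF x0] by (simp add: sets_prior)
  show ?thesis unfolding restricted_def
    by (subst nn_integral_density) (auto simp: ennreal_indicator, measurable)
qed

lemma AE_restricted_box:
  assumes x0: "x0 \<in> space (conf_space N)"
  shows "AE x in restricted N x0. \<forall>i<N. \<bar>x i\<bar> \<le> C"
proof -
  have [measurable]: "A N x0 \<in> sets (prior N)" using A_section[OF x0] by (simp add: sets_prior)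
  show ?thesis unfolding restricted_def
    by (subst AE_density) (use AE_PiM_box[OF PX, of N] in \<open>auto elim!: eventually_mono\<close>)
qed

text \<open>The signal enters also through the set \<open>A N x0\<close>, whose indicator is
  measurable in (x0, x) because the graph of A is.\<close>

lemma log_partition_measurable:
  fixes f :: "(nat \<Rightarrow> real) \<Rightarrow> nat \<times> nat \<Rightarrow> real \<Rightarrow> (nat \<Rightarrow> real) \<Rightarrow> real"
  assumes f: "\<And>e. e \<in> pairs N \<Longrightarrow> (\<lambda>p. f (fst (fst p)) e (snd (fst p) e) (snd p))
    \<in> borel_measurable ((conf_space N \<Otimes>\<^sub>M obs_space N) \<Otimes>\<^sub>M conf_space N)"
  shows "(\<lambda>z. log_partition (pairs N) (restricted N (fst z)) (f (fst z)) (snd z))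
    \<in> borel_measurable (conf_space N \<Otimes>\<^sub>M obs_space N)"
proof -
  interpret prob_space "prior N" by (rule prob_space_prior)
  let ?S = "SIGMA x0:space (conf_space N). A N x0"
  let ?Z = "conf_space N \<Otimes>\<^sub>M obs_space N"
  note [measurable] = A_graph[of N]
  have "(\<lambda>p. indicator ?S (fst (fst p), snd p) :: real) \<in> borel_measurable (?Z \<Otimes>\<^sub>M conf_space N)"
    by measurable
  moreover have "indicator ?S (fst (fst p), snd p) = (indicator (A N (fst (fst p))) (snd p) :: real)"
    if "p \<in> space (?Z \<Otimes>\<^sub>M conf_space N)" for p
    using that by (auto simp: indicator_def space_pair_measure)
  ultimately have [measurable]: "(\<lambda>p. indicator (A N (fst (fst p))) (snd p) :: real)
      \<in> borel_measurable (?Z \<Otimes>\<^sub>M conf_space N)"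
    by (subst (asm) measurable_cong) auto
  have [measurable]: "(\<lambda>p. \<Sum>e\<in>pairs N. f (fst (fst p)) e (snd (fst p) e) (snd p))
      \<in> borel_measurable (?Z \<Otimes>\<^sub>M conf_space N)"
    by (rule borel_measurable_sum) (rule f)
  have "(\<lambda>p. indicator (A N (fst (fst p))) (snd p) * exp (\<Sum>e\<in>pairs N. f (fst (fst p)) e (snd (fst p) e) (snd p)))
      \<in> borel_measurable (?Z \<Otimes>\<^sub>M conf_space N)"
    by measurable
  then have m [measurable]: "(\<lambda>(z, x). indicator (A N (fst z)) x * exp (\<Sum>e\<in>pairs N. f (fst z) e (snd z e) x))
      \<in> borel_measurable (?Z \<Otimes>\<^sub>M prior N)"
    by (simp add: split_beta' measurable_cong_sets[OF sets_pair_measure_cong[OF refl sets_prior] refl])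
  have "(\<lambda>z. ln (\<integral>x. indicator (A N (fst z)) x * exp (\<Sum>e\<in>pairs N. f (fst z) e (snd z e) x) \<partial>prior N))
      \<in> borel_measurable ?Z"
    by measurable
  moreover have "log_partition (pairs N) (restricted N (fst z)) (f (fst z)) (snd z)
      = ln (\<integral>x. indicator (A N (fst z)) x * exp (\<Sum>e\<in>pairs N. f (fst z) e (snd z e) x) \<partial>prior N)"
    if z: "z \<in> space ?Z" for z
  proof -
    have "fst z \<in> space (conf_space N)" using z by (auto simp: space_pair_measure)
    then have [measurable]: "A N (fst z) \<in> sets (prior N)" using A_section by (simp add: sets_prior)
    have "(\<lambda>x. \<Sum>e\<in>pairs N. f (fst (fst (z, x))) e (snd (fst (z, x)) e) (snd (z, x))) \<in> borel_measurable (conf_space N)"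
      by (rule measurable_compose[OF measurable_Pair1'[OF z]]) measurable
    then have [measurable]: "(\<lambda>x. \<Sum>e\<in>pairs N. f (fst z) e (snd z e) x) \<in> borel_measurable (conf_space N)"
      by simp
    show ?thesis unfolding log_partition_def restricted_def
      by (subst integral_density) auto
  qed
  ultimately show ?thesis by (subst measurable_cong) auto
qed

section \<open>Admissible energies and log-partition functions of the two models\<close>

lemma admissible_inference:
  assumes e: "e \<in> pairs N"
    and G: "\<And>y w. \<bar>w\<bar> \<le> C\<^sup>2 / sqrt (real N) \<Longrightarrow> \<bar>g y w - g y 0\<bar> \<le> G"
  shows "admissible (restricted N x0) (Pout g0 w) (inference_energy g C N e) (\<lambda>_. G)"
proof -
  interpret prob_space "Pout g0 w" by (rule channel)
  note [measurable] = borel_measurable_edge[OF e, of C] borel_measurable_section[OF g_meas]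
  have [measurable]: "(\<lambda>p. g (fst p) (edge C N (snd p) e)) \<in> borel_measurable (borel \<Otimes>\<^sub>M conf_space N)"
    using measurable_compose[OF _ g_meas, of "\<lambda>p. (fst p, edge C N (snd p) e)" "borel \<Otimes>\<^sub>M conf_space N"]
    by simp
  have "case_prod (inference_energy g C N e) \<in> borel_measurable (borel \<Otimes>\<^sub>M conf_space N)"
    unfolding inference_energy_def[abs_def] split_beta' by measurable
  then show ?thesis
    using G abs_edge_le[OF C_nonneg]
    by (auto simp: admissible_def inference_energy_def
        measurable_cong_sets[OF sets_pair_measure_cong[OF refl sets_restricted] refl])
qed

definition "gauss_bound \<beta> \<beta>_SNR \<beta>_S N y =
  \<bar>\<beta>\<bar> * \<bar>y\<bar> * (C\<^sup>2 / sqrt (real N)) + (\<bar>\<beta>_SNR\<bar> + \<bar>\<beta>_S\<bar>) * (C\<^sup>2 / sqrt (real N))\<^sup>2"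

lemma integrable_gauss_bound: "integrable std_normal_distribution (gauss_bound \<beta> \<beta>_SNR \<beta>_S N)"
proof -
  interpret prob_space std_normal_distribution by (rule prob_space_std_normal)
  show ?thesis unfolding gauss_bound_def
    using integrable_std_normal_abs_power[of 1] by simp
qed

lemma admissible_gauss:
  assumes e: "e \<in> pairs N"
  shows "admissible (restricted N x0) std_normal_distribution
    (gauss_energy \<beta> \<beta>_SNR \<beta>_S C N x0 e) (gauss_bound \<beta> \<beta>_SNR \<beta>_S N)"
proof -
  note [measurable] = borel_measurable_edge[OF e, of C]
  have m: "case_prod (gauss_energy \<beta> \<beta>_SNR \<beta>_S C N x0 e) \<in> borel_measurable (borel \<Otimes>\<^sub>M conf_space N)"
    unfolding gauss_energy_def[abs_def] split_beta' by measurable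
  have "\<bar>gauss_energy \<beta> \<beta>_SNR \<beta>_S C N x0 e y x\<bar> \<le> gauss_bound \<beta> \<beta>_SNR \<beta>_S N y" for y x
  proof -
    define m where "m = C\<^sup>2 / sqrt (real N)"
    have E: "\<bar>edge C N x e\<bar> \<le> m" for x unfolding m_def by (rule abs_edge_le[OF C_nonneg])
    have "\<bar>\<beta> * y * edge C N x e\<bar> \<le> \<bar>\<beta>\<bar> * \<bar>y\<bar> * m"
      unfolding abs_mult by (intro mult_left_mono E) auto
    moreover have "\<bar>\<beta>_SNR * edge C N x0 e * edge C N x e\<bar> \<le> \<bar>\<beta>_SNR\<bar> * m\<^sup>2"
      unfolding abs_mult mult.assoc power2_eq_square by (intro mult_left_mono mult_mono E order.trans[OF abs_ge_zero E]) auto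
    moreover have "\<bar>\<beta>_S * (edge C N x e)\<^sup>2 / 2\<bar> \<le> \<bar>\<beta>_S\<bar> * m\<^sup>2"
    proof -
      have "\<bar>\<beta>_S\<bar> * (edge C N x e)\<^sup>2 \<le> \<bar>\<beta>_S\<bar> * m\<^sup>2"
        using power_mono[OF E abs_ge_zero, of x 2] by (intro mult_left_mono) auto
      moreover have "0 \<le> \<bar>\<beta>_S\<bar> * (edge C N x e)\<^sup>2" by simp
      moreover have "\<bar>\<beta>_S * (edge C N x e)\<^sup>2 / 2\<bar> = \<bar>\<beta>_S\<bar> * (edge C N x e)\<^sup>2 / 2" by (simp add: abs_mult)
      ultimately show ?thesis by linarith
    qed
    ultimately show ?thesis unfolding gauss_energy_def gauss_bound_def m_def[symmetric] distrib_right by linarith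
  qed
  with m integrable_gauss_bound show ?thesis
    by (auto simp: admissible_def measurable_cong_sets[OF sets_pair_measure_cong[OF refl sets_restricted] refl])
qed

definition "inference_log N z = log_partition (pairs N) (restricted N (fst z)) (inference_energy g C N) (snd z)"

definition "gauss_log \<beta> \<beta>_SNR \<beta>_S N z =
  log_partition (pairs N) (restricted N (fst z)) (gauss_energy \<beta> \<beta>_SNR \<beta>_S C N (fst z)) (snd z)"

lemma inference_log_measurable: "inference_log N \<in> borel_measurable (conf_space N \<Otimes>\<^sub>M obs_space N)"
  unfolding inference_log_def[abs_def]
proof (rule log_partition_measurable)
  fix e assume e: "e \<in> pairs N"
  let ?Z = "(conf_space N \<Otimes>\<^sub>M obs_space N) \<Otimes>\<^sub>M conf_space N"
  note [measurable] = borel_measurable_edge[OF e, of C] borel_measurable_section[OF g_meas]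
    measurable_component_singleton[OF e, of "\<lambda>_. borel :: real measure"]
  have [measurable]: "(\<lambda>p. g (snd (fst p) e) (edge C N (snd p) e)) \<in> borel_measurable ?Z"
    using measurable_compose[OF _ g_meas, of "\<lambda>p. (snd (fst p) e, edge C N (snd p) e)" ?Z] by simp
  show "(\<lambda>p. inference_energy g C N e (snd (fst p) e) (snd p)) \<in> borel_measurable ?Z"
    unfolding inference_energy_def by measurable
qed

lemma gauss_log_measurable: "gauss_log \<beta> \<beta>_SNR \<beta>_S N \<in> borel_measurable (conf_space N \<Otimes>\<^sub>M obs_space N)"
  unfolding gauss_log_def[abs_def]
proof (rule log_partition_measurable)
  fix e assume e: "e \<in> pairs N"
  let ?Z = "(conf_space N \<Otimes>\<^sub>M obs_space N) \<Otimes>\<^sub>M conf_space N"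
  note [measurable] = borel_measurable_edge[OF e, of C]
    measurable_component_singleton[OF e, of "\<lambda>_. borel :: real measure"]
  show "(\<lambda>p. gauss_energy \<beta> \<beta>_SNR \<beta>_S C N (fst (fst p)) e (snd (fst p) e) (snd p)) \<in> borel_measurable ?Z"
    unfolding gauss_energy_def by measurable
qed

text \<open>Passage from the extended logarithm of the original partition function to the real one
  with clipped spins. H has to agree with the clipped energies only on the box, which carries the
  prior, and positive mass makes the logarithm finite.\<close>

lemma elog_restricted:
  assumes x0: "x0 \<in> space (conf_space N)" and pos: "mass N x0 > 0"
    and adm: "\<And>e. e \<in> pairs N \<Longrightarrow> admissible (restricted N x0) (M e) (f e) (b e)"
    and H [measurable]: "H \<in> borel_measurable (conf_space N)"
    and eq: "\<And>x. \<forall>i<N. \<bar>x i\<bar> \<le> C \<Longrightarrow> H x = c + (\<Sum>e\<in>pairs N. f e (Y e) x)"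
  shows "elog (\<integral>\<^sup>+ x. indicator (A N x0) x * ennreal (exp (H x)) \<partial>prior N)
    = ereal (c + log_partition (pairs N) (restricted N x0) f Y)"
proof -
  interpret finite_measure "restricted N x0" by (rule finite_measure_restricted[OF x0])
  have "(\<integral>\<^sup>+ x. indicator (A N x0) x * ennreal (exp (H x)) \<partial>prior N)
      = (\<integral>\<^sup>+ x. ennreal (exp (H x)) \<partial>restricted N x0)"
    by (rule nn_integral_restricted[OF x0, symmetric]) measurable
  also have "\<dots> = (\<integral>\<^sup>+ x. ennreal (exp (c + (\<Sum>e\<in>pairs N. f e (Y e) x))) \<partial>restricted N x0)"
    by (rule nn_integral_cong_AE) (use AE_restricted_box[OF x0] in \<open>eventually_elim\<close>, simp add: eq)
  also have "elog \<dots> = ereal (c + log_partition (pairs N) (restricted N x0) f Y)"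
    unfolding log_partition_def
  proof (rule elog_nn_integral_exp[where B = "\<Sum>e\<in>pairs N. b e (Y e)"])
    show "(\<lambda>x. \<Sum>e\<in>pairs N. f e (Y e) x) \<in> borel_measurable (restricted N x0)"
      by (rule borel_measurable_sum) (rule admissible_section[OF adm])
    show "\<bar>\<Sum>e\<in>pairs N. f e (Y e) x\<bar> \<le> (\<Sum>e\<in>pairs N. b e (Y e))" if "x \<in> space (restricted N x0)" for x
      by (intro order.trans[OF sum_abs] sum_mono) (use adm that in \<open>auto simp: admissible_def\<close>)
    show "0 < measure (restricted N x0) (space (restricted N x0))"
      using pos by (simp add: measure_restricted[OF x0])
  qed
  finally show ?thesis .
qed

text \<open>The mass is at most 1, so its extended logarithm has no positive part, and an infinite
  negative part would give \<open>F_zero\<close> the value -\<infinity>. Excluding this makes null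
  sections negligible and ln of the mass integrable.\<close>

lemma
  assumes N: "N > 0" and F: "F_zero P0 PX A N \<noteq> -\<infinity>"
  shows AE_mass_pos: "AE x0 in signal_law N. mass N x0 > 0"
    and integrable_ln_mass: "integrable (signal_law N) (\<lambda>x0. ln (mass N x0))"
proof -
  interpret X: prob_space "prior N" by (rule prob_space_prior)
  let ?E = "\<lambda>x0. elog (emeasure (prior N) (A N x0))"
  have [measurable]: "mass N \<in> borel_measurable (signal_law N)" using mass_measurable by measurable
  have mass: "0 \<le> mass N x0" "mass N x0 \<le> 1" for x0 by (simp_all add: mass_def)
  have E: "?E x0 = (if mass N x0 = 0 then -\<infinity> else ereal (ln (mass N x0)))" for x0
    using mass[of x0] by (auto simp: X.emeasure_eq_measure mass_def[symmetric] elog_def)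
  have 1: "e2ennreal (?E x0) = 0" for x0
    unfolding E by (rule e2ennreal_neg) (use mass[of x0] in auto)
  have 2: "e2ennreal (- ?E x0) = (if mass N x0 = 0 then \<infinity> else ennreal (- ln (mass N x0)))" for x0
    unfolding E by auto
  let ?X = "\<integral>\<^sup>+ x0. (if mass N x0 = 0 then \<infinity> else ennreal (- ln (mass N x0))) \<partial>signal_law N"
  have "?X \<noteq> \<infinity>"
  proof
    assume "?X = \<infinity>"
    then have "eexpectation (signal_law N) ?E = -\<infinity>"
      unfolding eexpectation_def 1 2 by (simp add: zero_ennreal.rep_eq)
    then show False using F N by (simp add: F_zero_def)
  qed
  then have "AE x0 in signal_law N. (if mass N x0 = 0 then \<infinity> else ennreal (- ln (mass N x0))) \<noteq> \<infinity>"
    by (intro nn_integral_PInf_AE) measurable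
  then show pos: "AE x0 in signal_law N. mass N x0 > 0"
    by eventually_elim (use mass(1) in \<open>auto simp: less_le split: if_splits\<close>)
  \<comment> \<open>Where the mass vanishes the real ln takes the value 0, while the right-hand
    integrand is \<infinity>.\<close>
  have "(\<integral>\<^sup>+ x0. ennreal (norm (ln (mass N x0))) \<partial>signal_law N) \<le> ?X"
    by (rule nn_integral_mono) (use mass in \<open>auto simp: less_le\<close>)
  then show "integrable (signal_law N) (\<lambda>x0. ln (mass N x0))"
    using \<open>?X \<noteq> \<infinity>\<close> by (intro integrableI_bounded) (auto simp: less_top top_unique)
qed

end


section \<open>Comparison of the free energies\<close>

context inference_problem
begin

lemma obs_law_eq:
  assumes "\<forall>i<N. \<bar>x0 i\<bar> \<le> C"
  shows "obs_law g0 N x0 = PiM (pairs N) (\<lambda>e. Pout g0 (edge C N x0 e))"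
  unfolding obs_law_def by (rule PiM_cong) (use assms in \<open>auto simp: edge_eq\<close>)

lemma nn_integral_obs_law_measurable:
  assumes "f \<in> borel_measurable (conf_space N \<Otimes>\<^sub>M obs_space N)"
  shows "(\<lambda>x0. \<integral>\<^sup>+ Y. f (x0, Y) \<partial>obs_law g0 N x0) \<in> borel_measurable (signal_law N)"
proof -
  have "(\<lambda>x0. \<integral>\<^sup>+ Y. f (x0, Y) \<partial>obs_law g0 N x0) \<in> borel_measurable (conf_space N)"
    by (rule nn_integral_measurable_subprob_algebra2[where f = "\<lambda>x Y. f (x, Y)"])
      (use assms measurable_prob_algebraD[OF obs_law_measurable[OF g0_meas channel]] in auto)
  then show ?thesis by measurable
qed

lemma elog_inference_log:
  assumes x0: "x0 \<in> space (conf_space N)" and pos: "mass N x0 > 0"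
    and G: "\<And>y w. \<bar>w\<bar> \<le> C\<^sup>2 / sqrt (real N) \<Longrightarrow> \<bar>g y w - g y 0\<bar> \<le> G"
  shows "elog (\<integral>\<^sup>+ x. indicator (A N x0) x *
       ennreal (exp (\<Sum>(i, j)\<in>pairs N. g (Y (i, j)) (x i * x j / sqrt (real N)))) \<partial>prior N)
     - ereal (\<Sum>(i, j)\<in>pairs N. g (Y (i, j)) 0) = ereal (inference_log N (x0, Y))"
proof -
  have "elog (\<integral>\<^sup>+ x. indicator (A N x0) x *
       ennreal (exp (\<Sum>(i, j)\<in>pairs N. g (Y (i, j)) (x i * x j / sqrt (real N)))) \<partial>prior N)
     = ereal ((\<Sum>e\<in>pairs N. g (Y e) 0)
         + log_partition (pairs N) (restricted N x0) (inference_energy g C N) Y)"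
  proof (rule elog_restricted[OF x0 pos])
    \<comment> \<open>The bound G holds under every channel law; \<open>Pout g0 0\<close> is one
      choice among them.\<close>
    show "admissible (restricted N x0) (Pout g0 0) (inference_energy g C N e) (\<lambda>_. G)" if "e \<in> pairs N" for e
      by (rule admissible_inference[OF that G])
    have "(\<lambda>x. g (Y (i, j)) (x i * x j / sqrt (real N))) \<in> borel_measurable (conf_space N)"
      if e: "(i, j) \<in> pairs N" for i j
    proof -
      have [measurable]: "(\<lambda>x. x i) \<in> borel_measurable (conf_space N)" "(\<lambda>x. x j) \<in> borel_measurable (conf_space N)"
        using e by (auto simp: pairs_def intro: measurable_component_singleton)
      show ?thesis
        using measurable_compose[OF _ g_meas, of "\<lambda>x. (Y (i, j), x i * x j / sqrt (real N))" "conf_space N"]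
        by simp
    qed
    then show "(\<lambda>x. \<Sum>(i, j)\<in>pairs N. g (Y (i, j)) (x i * x j / sqrt (real N))) \<in> borel_measurable (conf_space N)"
      by (auto intro!: borel_measurable_sum)
    fix x assume x: "\<forall>i<N. \<bar>x i\<bar> \<le> C"
    show "(\<Sum>(i, j)\<in>pairs N. g (Y (i, j)) (x i * x j / sqrt (real N)))
        = (\<Sum>e\<in>pairs N. g (Y e) 0) + (\<Sum>e\<in>pairs N. inference_energy g C N e (Y e) x)"
      unfolding sum.distrib[symmetric]
      by (rule sum.cong) (auto simp: inference_energy_def edge_eq[OF x])
  qed
  then show ?thesis by (simp add: inference_log_def split_beta')
qed

text \<open>The signal must lie in the box too, since the Hamiltonian contains x0 itself and
  \<open>gauss_energy\<close> its clipped version.\<close>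

lemma elog_gauss_log:
  assumes x0: "x0 \<in> space (conf_space N)" "\<forall>i<N. \<bar>x0 i\<bar> \<le> C" and pos: "mass N x0 > 0"
  shows "elog (\<integral>\<^sup>+ x. indicator (A N x0) x * ennreal (exp (gauss_hamiltonian \<beta> \<beta>_SNR \<beta>_S N x0 W x)) \<partial>prior N)
     = ereal (gauss_log \<beta> \<beta>_SNR \<beta>_S N (x0, W))"
proof -
  have "elog (\<integral>\<^sup>+ x. indicator (A N x0) x * ennreal (exp (gauss_hamiltonian \<beta> \<beta>_SNR \<beta>_S N x0 W x)) \<partial>prior N)
     = ereal (0 + log_partition (pairs N) (restricted N x0) (gauss_energy \<beta> \<beta>_SNR \<beta>_S C N x0) W)"
  proof (rule elog_restricted[OF x0(1) pos])
    show "admissible (restricted N x0) std_normal_distribution (gauss_energy \<beta> \<beta>_SNR \<beta>_S C N x0 e)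
        (gauss_bound \<beta> \<beta>_SNR \<beta>_S N)" if "e \<in> pairs N" for e
      by (rule admissible_gauss[OF that])
    have m: "(\<lambda>x. \<beta> * W (i, j) / sqrt (real N) * x i * x j + \<beta>_SNR / real N * x i * x j * x0 i * x0 j
        + \<beta>_S / (2 * real N) * (x i * x j)\<^sup>2) \<in> borel_measurable (conf_space N)"
      if e: "(i, j) \<in> pairs N" for i j
    proof -
      have [measurable]: "(\<lambda>x. x i) \<in> borel_measurable (conf_space N)" "(\<lambda>x. x j) \<in> borel_measurable (conf_space N)"
        using e by (auto simp: pairs_def intro: measurable_component_singleton)
      show ?thesis by measurable
    qed
    show "gauss_hamiltonian \<beta> \<beta>_SNR \<beta>_S N x0 W \<in> borel_measurable (conf_space N)"
      unfolding gauss_hamiltonian_def[abs_def] by (rule borel_measurable_sum) (use m in auto)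
    fix x assume x: "\<forall>i<N. \<bar>x i\<bar> \<le> C"
    show "gauss_hamiltonian \<beta> \<beta>_SNR \<beta>_S N x0 W x
        = 0 + (\<Sum>e\<in>pairs N. gauss_energy \<beta> \<beta>_SNR \<beta>_S C N x0 e (W e) x)"
      unfolding gauss_hamiltonian_def add_0
    proof (rule sum.cong[OF refl], clarify)
      fix i j assume e: "(i, j) \<in> pairs N"
      then have N: "real N > 0" by (auto simp: pairs_def)
      show "\<beta> * W (i, j) / sqrt (real N) * x i * x j + \<beta>_SNR / real N * x i * x j * x0 i * x0 j
          + \<beta>_S / (2 * real N) * (x i * x j)\<^sup>2 = gauss_energy \<beta> \<beta>_SNR \<beta>_S C N x0 (i, j) (W (i, j)) x"
        using N by (simp add: gauss_energy_def edge_eq[OF x e] edge_eq[OF x0(2) e] power_divide mult_ac)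
    qed
  qed
  then show ?thesis by (simp add: gauss_log_def)
qed

text \<open>Given x0 in the box, the observations are independent with laws
  \<open>Pout g0 (edge C N x0 e)\<close>, so the replacement applies with that edge variable as
  w.\<close>

lemma inference_gauss_comparison:
  fixes c :: real
  assumes x0: "x0 \<in> space (conf_space N)" "\<forall>i<N. \<bar>x0 i\<bar> \<le> C" and pos: "mass N x0 > 0"
    and G: "\<And>y w. \<bar>w\<bar> \<le> C\<^sup>2 / sqrt (real N) \<Longrightarrow> \<bar>g y w - g y 0\<bar> \<le> G"
    and pair: "\<And>(\<mu> :: (nat \<Rightarrow> real) measure) a w. prob_space \<mu> \<Longrightarrow> a \<in> borel_measurable \<mu> \<Longrightarrow>
      (\<And>x. x \<in> space \<mu> \<Longrightarrow> \<bar>a x\<bar> \<le> C\<^sup>2 / sqrt (real N)) \<Longrightarrow> \<bar>w\<bar> \<le> C\<^sup>2 / sqrt (real N) \<Longrightarrow>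
      \<bar>(\<integral>y. ln (\<integral>x. exp (g y (a x) - g y 0) \<partial>\<mu>) \<partial>Pout g0 w)
        - (\<integral>y. ln (\<integral>x. exp (\<beta> * y * a x + \<beta>_SNR * w * a x + \<beta>_S * (a x)\<^sup>2 / 2) \<partial>\<mu>)
            \<partial>std_normal_distribution)\<bar> \<le> c"
  shows "\<bar>(\<integral>Y. inference_log N (x0, Y) \<partial>obs_law g0 N x0)
    - (\<integral>W. gauss_log \<beta> \<beta>_SNR \<beta>_S N (x0, W) \<partial>noise_law N)\<bar> \<le> card (pairs N) * c"
  unfolding obs_law_eq[OF x0(2)] inference_log_def gauss_log_def fst_conv snd_conv
proof (rule log_partition_Lindeberg[OF finite_measure_restricted[OF x0(1)]])
  show "0 < measure (restricted N x0) (space (restricted N x0))"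
    using pos by (simp add: measure_restricted[OF x0(1)])
  fix e assume e: "e \<in> pairs N"
  show "admissible (restricted N x0) (Pout g0 (edge C N x0 e)) (inference_energy g C N e) (\<lambda>_. G)"
    by (rule admissible_inference[OF e G])
  show "admissible (restricted N x0) std_normal_distribution (gauss_energy \<beta> \<beta>_SNR \<beta>_S C N x0 e)
      (gauss_bound \<beta> \<beta>_SNR \<beta>_S N)"
    by (rule admissible_gauss[OF e])
  fix \<mu> :: "(nat \<Rightarrow> real) measure" assume \<mu>: "prob_space \<mu>" "sets \<mu> = sets (restricted N x0)"
  have "(\<lambda>x. edge C N x e) \<in> borel_measurable \<mu>"
    using borel_measurable_edge[OF e] by (simp add: measurable_cong_sets[OF \<mu>(2)[unfolded sets_restricted] refl])
  from pair[OF \<mu>(1) this abs_edge_le[OF C_nonneg] abs_edge_le[OF C_nonneg]]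
  show "\<bar>(\<integral>y. ln (\<integral>x. exp (inference_energy g C N e y x) \<partial>\<mu>) \<partial>Pout g0 (edge C N x0 e))
      - (\<integral>y. ln (\<integral>x. exp (gauss_energy \<beta> \<beta>_SNR \<beta>_S C N x0 e y x) \<partial>\<mu>) \<partial>std_normal_distribution)\<bar> \<le> c"
    by (simp add: inference_energy_def gauss_energy_def)
qed (auto intro: channel prob_space_std_normal)

text \<open>The bound for fixed x0 is uniform over almost all signals, and both joint laws have the
  same signal marginal, so it survives integration over x0. Before that, each extended expectation
  must be identified with a Bochner integral; the hypothesis on \<open>F_zero\<close> provides the
  dominating function |ln mass| and the positivity of the mass.\<close>

lemma free_energy_comparison:
  fixes c :: real
  assumes N: "N > 0" and F: "F_zero P0 PX A N \<noteq> -\<infinity>"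
    and G: "\<And>y w. \<bar>w\<bar> \<le> C\<^sup>2 / sqrt (real N) \<Longrightarrow> \<bar>g y w - g y 0\<bar> \<le> G"
    and pair: "\<And>(\<mu> :: (nat \<Rightarrow> real) measure) a w. prob_space \<mu> \<Longrightarrow> a \<in> borel_measurable \<mu> \<Longrightarrow>
      (\<And>x. x \<in> space \<mu> \<Longrightarrow> \<bar>a x\<bar> \<le> C\<^sup>2 / sqrt (real N)) \<Longrightarrow> \<bar>w\<bar> \<le> C\<^sup>2 / sqrt (real N) \<Longrightarrow>
      \<bar>(\<integral>y. ln (\<integral>x. exp (g y (a x) - g y 0) \<partial>\<mu>) \<partial>Pout g0 w)
        - (\<integral>y. ln (\<integral>x. exp (\<beta> * y * a x + \<beta>_SNR * w * a x + \<beta>_S * (a x)\<^sup>2 / 2) \<partial>\<mu>)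
            \<partial>std_normal_distribution)\<bar> \<le> c"
  shows "\<bar>F_inf g g0 P0 PX A N - F_gauss \<beta> \<beta>_SNR \<beta>_S P0 PX A N\<bar> \<le> ereal (card (pairs N) * c / real N)"
proof -
  let ?J = "inference_law g0 P0 N" and ?J' = "signal_law N \<Otimes>\<^sub>M noise_law N"
  let ?h = "inference_log N" and ?h' = "gauss_log \<beta> \<beta>_SNR \<beta>_S N"
  interpret S: prob_space "signal_law N" by (rule prob_space_signal_law)
  interpret W: prob_space "noise_law N" by (rule prob_space_noise_law)
  interpret J: prob_space ?J by (rule prob_space_inference_law[OF g0_meas channel P0(1,2)])
  interpret J': pair_prob_space "signal_law N" "noise_law N" ..
  note sJ = sets_inference_law[OF g0_meas channel P0(1,2), of N]
  have sJ': "sets ?J' = sets (conf_space N \<Otimes>\<^sub>M obs_space N)"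
    by (rule sets_pair_measure_cong) (rule sets_signal_law sets_noise_law)+
  note [measurable_cong] = sJ sJ'
  \<comment> \<open>The signals for which both extended logarithms are finite and clipping x0
    changes nothing.\<close>
  define good where "good x0 \<longleftrightarrow> x0 \<in> space (conf_space N) \<and> (\<forall>i<N. \<bar>x0 i\<bar> \<le> C) \<and> mass N x0 > 0" for x0
  have good: "AE x0 in signal_law N. good x0"
    using AE_mass_pos[OF N F] AE_PiM_box[OF P0, of N] AE_space
    by eventually_elim (simp add: good_def space_signal_law)
  have dJ: "distr ?J (conf_space N) fst = signal_law N"
    by (rule distr_inference_law_fst[OF g0_meas channel P0(1,2)])
  have fJ: "fst \<in> measurable ?J (conf_space N)" by measurable
  have goodJ: "AE z in ?J. good (fst z)"
    by (rule AE_distrD[OF fJ], unfold dJ) (rule good)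
  have dJ': "distr ?J' (signal_law N) fst = signal_law N" by (rule W.distr_pair_fst)
  have goodJ': "AE z in ?J'. good (fst z)"
    by (rule AE_distrD[OF measurable_fst], unfold dJ') (rule good)
  have m: "?h \<in> borel_measurable ?J" "?h' \<in> borel_measurable ?J'"
    using inference_log_measurable gauss_log_measurable by (simp_all add: measurable_cong_sets[OF sJ refl] measurable_cong_sets[OF sJ' refl])
  note L = integrable_ln_mass[OF N F]
  have LJ: "integrable ?J (\<lambda>z. ln (mass N (fst z)))"
    by (rule integrable_distr[OF fJ]) (simp add: dJ L)
  have LJ': "integrable ?J' (\<lambda>z. ln (mass N (fst z)))"
    by (rule integrable_distr[OF measurable_fst]) (simp add: dJ' L)
  have intJ: "integrable ?J ?h"
  proof (rule Bochner_Integration.integrable_bound[OF _ m(1)])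
    show "integrable ?J (\<lambda>z. \<bar>ln (mass N (fst z))\<bar> + card (pairs N) * G)" using LJ by simp
    show "AE z in ?J. norm (?h z) \<le> norm (\<bar>ln (mass N (fst z))\<bar> + card (pairs N) * G)"
      using goodJ
    proof eventually_elim
      fix z :: "(nat \<Rightarrow> real) \<times> (nat \<times> nat \<Rightarrow> real)" assume "good (fst z)"
      then show "norm (?h z) \<le> norm (\<bar>ln (mass N (fst z))\<bar> + card (pairs N) * G)"
        using log_partition_bound[where \<nu> = "restricted N (fst z)" and I = "pairs N" and Y = "snd z"
            and M = "\<lambda>_. Pout g0 0" and f = "inference_energy g C N" and b = "\<lambda>_ _. G",
            OF finite_measure_restricted _ admissible_inference[OF _ G]]
        by (simp add: good_def inference_log_def measure_restricted)
    qed
  qed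
  let ?b = "\<lambda>W. \<Sum>e\<in>pairs N. gauss_bound \<beta> \<beta>_SNR \<beta>_S N (W e)"
  have intJ': "integrable ?J' ?h'"
  proof (rule Bochner_Integration.integrable_bound[OF _ m(2)])
    have "integrable (noise_law N) ?b"
      by (intro Bochner_Integration.integrable_sum integrable_PiM_component prob_space_std_normal
          integrable_gauss_bound)
    \<comment> \<open>The marginal fact concerns the first factor, so the noise bound is integrated
      on the swapped product and carried back.\<close>
    then have "integrable (distr (noise_law N \<Otimes>\<^sub>M signal_law N) (noise_law N) fst) ?b"
      by (simp only: S.distr_pair_fst)
    then have "integrable (noise_law N \<Otimes>\<^sub>M signal_law N) (\<lambda>z. ?b (fst z))"
      by (rule integrable_distr[OF measurable_fst])
    then have "integrable ?J' (\<lambda>z. ?b (snd z))"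
      by (subst J'.integrable_product_swap_iff[symmetric]) (simp add: split_beta')
    then show "integrable ?J' (\<lambda>z. \<bar>ln (mass N (fst z))\<bar> + ?b (snd z))" using LJ' by simp
    show "AE z in ?J'. norm (?h' z) \<le> norm (\<bar>ln (mass N (fst z))\<bar> + ?b (snd z))"
      using goodJ'
    proof eventually_elim
      fix z :: "(nat \<Rightarrow> real) \<times> (nat \<times> nat \<Rightarrow> real)" assume "good (fst z)"
      then show "norm (?h' z) \<le> norm (\<bar>ln (mass N (fst z))\<bar> + ?b (snd z))"
        using log_partition_bound[where \<nu> = "restricted N (fst z)" and I = "pairs N" and Y = "snd z"
            and M = "\<lambda>_. std_normal_distribution" and f = "gauss_energy \<beta> \<beta>_SNR \<beta>_S C N (fst z)"
            and b = "\<lambda>_. gauss_bound \<beta> \<beta>_SNR \<beta>_S N",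
            OF finite_measure_restricted _ admissible_gauss]
        by (simp add: good_def gauss_log_def measure_restricted)
    qed
  qed
  have Finf: "F_inf g g0 P0 PX A N = ereal (1 / real N) * ereal (\<integral>z. ?h z \<partial>?J)"
    unfolding F_inf_def
  proof (subst eexpectation_eq_integral[OF intJ])
    show "AE z in ?J. (case z of (x0, Y) \<Rightarrow> elog (\<integral>\<^sup>+ x. indicator (A N x0) x *
       ennreal (exp (\<Sum>(i, j)\<in>pairs N. g (Y (i, j)) (x i * x j / sqrt (real N)))) \<partial>prior N)
       - ereal (\<Sum>(i, j)\<in>pairs N. g (Y (i, j)) 0)) = ereal (?h z)"
      using goodJ
    proof eventually_elim
      fix z :: "(nat \<Rightarrow> real) \<times> (nat \<times> nat \<Rightarrow> real)" assume *: "good (fst z)"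
      obtain x0 Y where z: "z = (x0, Y)" by (cases z)
      show "(case z of (x0, Y) \<Rightarrow> elog (\<integral>\<^sup>+ x. indicator (A N x0) x *
         ennreal (exp (\<Sum>(i, j)\<in>pairs N. g (Y (i, j)) (x i * x j / sqrt (real N)))) \<partial>prior N)
         - ereal (\<Sum>(i, j)\<in>pairs N. g (Y (i, j)) 0)) = ereal (?h z)"
        unfolding z prod.case by (rule elog_inference_log[OF _ _ G]) (use * z in \<open>auto simp: good_def\<close>)
    qed
  qed simp
  have Fgauss: "F_gauss \<beta> \<beta>_SNR \<beta>_S P0 PX A N = ereal (1 / real N) * ereal (\<integral>z. ?h' z \<partial>?J')"
    unfolding F_gauss_def
  proof (subst eexpectation_eq_integral[OF intJ'])
    show "AE z in ?J'. (case z of (x0, W) \<Rightarrow> elog (\<integral>\<^sup>+ x. indicator (A N x0) x *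
       ennreal (exp (gauss_hamiltonian \<beta> \<beta>_SNR \<beta>_S N x0 W x)) \<partial>prior N)) = ereal (?h' z)"
      using goodJ'
      by eventually_elim (auto simp: good_def elog_gauss_log split: prod.split)
  qed simp
  \<comment> \<open>Conditional means given the signal, over the channel and over the Gaussian
    noise.\<close>
  let ?\<kappa> = "\<lambda>x0. \<integral>Y. ?h (x0, Y) \<partial>obs_law g0 N x0" and ?\<kappa>' = "\<lambda>x0. \<integral>W. ?h' (x0, W) \<partial>noise_law N"
  have sec: "(\<lambda>Y. ?h (x0, Y)) \<in> borel_measurable (obs_law g0 N x0)" if "x0 \<in> space (signal_law N)" for x0
    using measurable_compose[OF measurable_Pair1' inference_log_measurable] that
    by (simp add: measurable_cong_sets[OF sets_obs_law refl] space_signal_law)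
  have dm: "(\<lambda>x0. \<integral>\<^sup>+ Y. f (x0, Y) \<partial>obs_law g0 N x0) \<in> borel_measurable (signal_law N)"
    and di: "(\<integral>\<^sup>+ z. f z \<partial>?J) = (\<integral>\<^sup>+ x0. \<integral>\<^sup>+ Y. f (x0, Y) \<partial>obs_law g0 N x0 \<partial>signal_law N)"
    if "f \<in> borel_measurable ?J" for f
  proof -
    have "f \<in> borel_measurable (conf_space N \<Otimes>\<^sub>M obs_space N)"
      using that by (simp only: measurable_cong_sets[OF sJ refl])
    then show "(\<lambda>x0. \<integral>\<^sup>+ Y. f (x0, Y) \<partial>obs_law g0 N x0) \<in> borel_measurable (signal_law N)"
      "(\<integral>\<^sup>+ z. f z \<partial>?J) = (\<integral>\<^sup>+ x0. \<integral>\<^sup>+ Y. f (x0, Y) \<partial>obs_law g0 N x0 \<partial>signal_law N)"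
      by (rule nn_integral_obs_law_measurable nn_integral_inference_law[OF g0_meas channel P0(1,2)])+
  qed
  have \<kappa>1: "integrable (signal_law N) ?\<kappa>"
    by (rule integrable_disintegration[where J = ?J and K = "obs_law g0 N" and h = ?h, OF dm di sec intJ])
  have \<kappa>2: "(\<integral>z. ?h z \<partial>?J) = (\<integral>x0. ?\<kappa> x0 \<partial>signal_law N)"
    by (rule integral_disintegration[where J = ?J and K = "obs_law g0 N" and h = ?h, OF dm di sec intJ])
  have \<kappa>': "integrable (signal_law N) ?\<kappa>'" "(\<integral>z. ?h' z \<partial>?J') = (\<integral>x0. ?\<kappa>' x0 \<partial>signal_law N)"
    by (rule J'.integrable_fst'[OF intJ']) (rule J'.integral_fst'[OF intJ', symmetric])
  have "\<bar>(\<integral>z. ?h z \<partial>?J) - (\<integral>z. ?h' z \<partial>?J')\<bar> = \<bar>\<integral>x0. ?\<kappa> x0 - ?\<kappa>' x0 \<partial>signal_law N\<bar>"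
    using \<kappa>1 \<kappa>2 \<kappa>' by simp
  also have "\<dots> \<le> card (pairs N) * c"
  proof (intro order.trans[OF integral_abs_bound] S.integral_le_const)
    show "integrable (signal_law N) (\<lambda>x0. \<bar>?\<kappa> x0 - ?\<kappa>' x0\<bar>)" using \<kappa>1 \<kappa>' by simp
    show "AE x0 in signal_law N. \<bar>?\<kappa> x0 - ?\<kappa>' x0\<bar> \<le> card (pairs N) * c"
      using good
    proof eventually_elim
      fix x0 assume "good x0"
      then show "\<bar>?\<kappa> x0 - ?\<kappa>' x0\<bar> \<le> card (pairs N) * c"
        by (intro inference_gauss_comparison[OF _ _ _ G pair]) (auto simp: good_def)
    qed
  qed
  finally have "\<bar>(\<integral>z. ?h z \<partial>?J) - (\<integral>z. ?h' z \<partial>?J')\<bar> \<le> card (pairs N) * c" .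
  then have "\<bar>(\<integral>z. ?h z \<partial>?J) / real N - (\<integral>z. ?h' z \<partial>?J') / real N\<bar> \<le> card (pairs N) * c / real N"
    using N by (simp add: diff_divide_distrib[symmetric] divide_right_mono)
  then show ?thesis unfolding Finf Fgauss by simp
qed

end

section \<open>Uniform constants and the limit of large N\<close>

lemma channel_increment_bounded:
  assumes "regularity_hyp g g0" and m: "0 \<le> m"
  obtains G where "\<And>y w. \<bar>w\<bar> \<le> m \<Longrightarrow> \<bar>g y w - g y 0\<bar> \<le> G"
proof -
  obtain G1 G2 G3 where G: "\<And>y. \<bar>dw 1 g y 0\<bar> \<le> G1" "\<And>y. \<bar>dw 2 g y 0\<bar> \<le> G2" "\<And>y w. \<bar>dw 3 g y w\<bar> \<le> G3"
    using assms by (auto simp: regularity_hyp_def bounded_iff simp del: One_nat_def)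
  have g3: "times_differentiable_w 3 g" using assms by (simp add: regularity_hyp_def)
  have "\<bar>g y w - g y 0\<bar> \<le> G1 * m + G2 * m\<^sup>2 + G3 * m ^ 3" if w: "\<bar>w\<bar> \<le> m" for y w
  proof -
    have nn: "0 \<le> G1" "0 \<le> G2" "0 \<le> G3" using G(1)[of 0] G(2)[of 0] G(3)[of 0 0] by linarith+
    have 1: "\<bar>dw 1 g y 0 * w\<bar> \<le> G1 * m" unfolding abs_mult by (intro mult_mono G w) (use nn in auto)
    have "w\<^sup>2 \<le> m\<^sup>2" using w m by (simp add: power2_le_iff_abs_le)
    then have 2: "\<bar>dw 2 g y 0 * w\<^sup>2\<bar> \<le> G2 * m\<^sup>2" unfolding abs_mult by (intro mult_mono G) (use nn in auto)
    have 3: "G3 * \<bar>w\<bar> ^ 3 \<le> G3 * m ^ 3" by (intro mult_left_mono power_mono w nn) simp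
    show ?thesis using channel_Taylor[OF g3 G(3), of y w] 1 2 3 by linarith
  qed
  then show ?thesis by (rule that)
qed

lemma card_pairs_le: "card (pairs N) \<le> N\<^sup>2"
proof -
  have "card (pairs N) \<le> card ({..<N} \<times> {..<N})"
    by (rule card_mono) (auto simp: pairs_def)
  then show ?thesis by (simp add: power2_eq_square)
qed

lemma whole_space_measurable: "measurable_set_family whole_space"
  by (simp add: measurable_set_family_def whole_space_def)

lemma F_zero_whole_space:
  assumes "prob_space P0" "prob_space PX" "sets PX = sets borel"
  shows "F_zero P0 PX whole_space N = 0"
proof -
  interpret S: prob_space "PiM {..<N} (\<lambda>_. P0)" by (rule prob_space_PiM) (rule assms)
  interpret X: prob_space "PiM {..<N} (\<lambda>_. PX)" by (rule prob_space_PiM) (rule assms)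
  have "sets (PiM {..<N} (\<lambda>_. PX)) = sets (conf_space N)"
    by (rule sets_PiM_cong) (auto simp: assms)
  then have "space (PiM {..<N} (\<lambda>_. PX)) = space (conf_space N)" by (rule sets_eq_imp_space_eq)
  then have "elog (emeasure (PiM {..<N} (\<lambda>_. PX)) (whole_space N x0)) = ereal 0" for x0
    using X.emeasure_space_1 by (simp add: whole_space_def elog_def)
  then have "eexpectation (PiM {..<N} (\<lambda>_. P0)) (\<lambda>x0. elog (emeasure (PiM {..<N} (\<lambda>_. PX)) (whole_space N x0)))
      = ereal (\<integral>x0. 0 \<partial>PiM {..<N} (\<lambda>_. P0))"
    by (intro eexpectation_eq_integral) auto
  then show ?thesis by (simp add: F_zero_def)
qed

theorem proposition2p4:
  fixes g g0 :: "real \<Rightarrow> real \<Rightarrow> real"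
    and P0 PX :: "real measure"
    and C \<beta> \<beta>_SNR \<beta>_S :: real
  assumes P0: "prob_space P0" "sets P0 = sets borel" "measure P0 {-C..C} = 1"
    and PX: "prob_space PX" "sets PX = sets borel" "measure PX {-C..C} = 1"
    and meas: "case_prod g \<in> borel_measurable (borel \<Otimes>\<^sub>M borel)"
      "case_prod g0 \<in> borel_measurable (borel \<Otimes>\<^sub>M borel)"
    and channel: "\<And>w. prob_space (Pout g0 w)"
    and regular: "regularity_hyp g g0"
    and dominated: "channel_dominated g0"
    and consistent: "consistency_hyp g g0"
    and \<beta>: "\<beta> = sqrt (\<integral>y. (dw 1 g y 0)\<^sup>2 \<partial>Pout g0 0)"
    and \<beta>_SNR: "\<beta>_SNR = (\<integral>y. dw 1 g y 0 * dw 1 g0 y 0 \<partial>Pout g0 0)"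
    and \<beta>_S: "\<beta>_S = (\<integral>y. dw 2 g y 0 \<partial>Pout g0 0)"
  shows "(\<exists>K::real. \<forall>\<^sub>F N in sequentially.
            \<bar>F_inf g g0 P0 PX whole_space N - F_gauss \<beta> \<beta>_SNR \<beta>_S P0 PX whole_space N\<bar>
              \<le> ereal (K / sqrt (real N))) \<and>
         (\<forall>A. measurable_set_family A \<longrightarrow> liminf (F_zero P0 PX A) > -\<infinity> \<longrightarrow>
           (\<exists>K::real. \<forall>\<^sub>F N in sequentially.
            \<bar>F_inf g g0 P0 PX A N - F_gauss \<beta> \<beta>_SNR \<beta>_S P0 PX A N\<bar>
              \<le> ereal (K / sqrt (real N))))"
proof -
  \<comment> \<open>m0 = C^2 serves all N \<ge> 1, since edge variables are at most C^2 / sqrt N; K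
    and \<delta> are thus fixed before A and N.\<close>
  obtain K \<delta> where K: "K \<ge> 0" and \<delta>: "\<delta> > 0" and pair:
    "\<And>(\<mu> :: (nat \<Rightarrow> real) measure) a m w. prob_space \<mu> \<Longrightarrow> a \<in> borel_measurable \<mu> \<Longrightarrow>
      (\<And>x. x \<in> space \<mu> \<Longrightarrow> \<bar>a x\<bar> \<le> m) \<Longrightarrow> m \<le> C\<^sup>2 \<Longrightarrow> \<bar>w\<bar> \<le> m \<Longrightarrow> \<bar>w\<bar> \<le> \<delta> \<Longrightarrow>
      \<bar>(\<integral>y. ln (\<integral>x. exp (g y (a x) - g y 0) \<partial>\<mu>) \<partial>Pout g0 w)
        - (\<integral>y. ln (\<integral>x. exp (\<beta> * y * a x + \<beta>_SNR * w * a x + \<beta>_S * (a x)\<^sup>2 / 2) \<partial>\<mu>)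
            \<partial>std_normal_distribution)\<bar> \<le> K * m ^ 3"
    using one_pair_comparison[OF meas channel regular dominated consistent \<beta> \<beta>_SNR \<beta>_S, of "C\<^sup>2"] by blast
  obtain G where G: "\<And>y w. \<bar>w\<bar> \<le> C\<^sup>2 \<Longrightarrow> \<bar>g y w - g y 0\<bar> \<le> G"
    using channel_increment_bounded[OF regular, of "C\<^sup>2"] by auto
  have main: "\<exists>K::real. \<forall>\<^sub>F N in sequentially.
      \<bar>F_inf g g0 P0 PX A N - F_gauss \<beta> \<beta>_SNR \<beta>_S P0 PX A N\<bar> \<le> ereal (K / sqrt (real N))"
    if A: "measurable_set_family A" and F: "liminf (F_zero P0 PX A) > -\<infinity>" for A
  proof -
    interpret inference_problem g g0 P0 PX C A
      by (rule inference_problem.intro) (fact P0 PX meas channel A)+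
    have "\<forall>\<^sub>F N in sequentially. F_zero P0 PX A N > -\<infinity>" using F by (rule less_LiminfD)
    \<comment> \<open>Large N brings the edge variables of the signal into the range |w| \<le>
      \<delta> of the channel expansion.\<close>
    moreover have "(\<lambda>N. C\<^sup>2 / sqrt (real N)) \<longlonglongrightarrow> 0"
      by (intro tendsto_divide_0[OF tendsto_const] filterlim_at_top_imp_at_infinity
          filterlim_compose[OF sqrt_at_top] filterlim_real_sequentially)
    then have "\<forall>\<^sub>F N in sequentially. C\<^sup>2 / sqrt (real N) < \<delta>" by (rule order_tendstoD(2)[OF _ \<delta>])
    ultimately have "\<forall>\<^sub>F N in sequentially. \<bar>F_inf g g0 P0 PX A N - F_gauss \<beta> \<beta>_SNR \<beta>_S P0 PX A N\<bar>
        \<le> ereal (K * C ^ 6 / sqrt (real N))"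
      using eventually_gt_at_top[of 0]
    proof eventually_elim
      case (elim N)
      define s where "s = sqrt (real N)"
      have s: "s \<ge> 1" "s\<^sup>2 = real N" using elim(3) by (auto simp: s_def)
      have m: "C\<^sup>2 / s \<le> C\<^sup>2" using s(1) by (simp add: divide_le_eq mult_left_mono[of 1 s "C\<^sup>2", simplified])
      have "\<bar>F_inf g g0 P0 PX A N - F_gauss \<beta> \<beta>_SNR \<beta>_S P0 PX A N\<bar>
          \<le> ereal (card (pairs N) * (K * (C\<^sup>2 / s) ^ 3) / real N)"
      proof (rule free_energy_comparison[where G = G])
        show "\<bar>g y w - g y 0\<bar> \<le> G" if "\<bar>w\<bar> \<le> C\<^sup>2 / sqrt (real N)" for y w
          using that m by (intro G) (simp add: s_def)
        fix \<mu> :: "(nat \<Rightarrow> real) measure" and a w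
        assume "prob_space \<mu>" "a \<in> borel_measurable \<mu>"
          "\<And>x. x \<in> space \<mu> \<Longrightarrow> \<bar>a x\<bar> \<le> C\<^sup>2 / sqrt (real N)" "\<bar>w\<bar> \<le> C\<^sup>2 / sqrt (real N)"
        then show "\<bar>(\<integral>y. ln (\<integral>x. exp (g y (a x) - g y 0) \<partial>\<mu>) \<partial>Pout g0 w)
          - (\<integral>y. ln (\<integral>x. exp (\<beta> * y * a x + \<beta>_SNR * w * a x + \<beta>_S * (a x)\<^sup>2 / 2) \<partial>\<mu>)
              \<partial>std_normal_distribution)\<bar> \<le> K * (C\<^sup>2 / s) ^ 3"
          using m elim(2) by (intro pair) (auto simp: s_def)
      qed (use elim in auto)
      \<comment> \<open>Powers of s = sqrt N: s^4 from the pairs, s^(-3) from the error of one pair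
        and s^(-2) from the prefactor 1 / N leave 1 / s.\<close>
      also have "card (pairs N) * (K * (C\<^sup>2 / s) ^ 3) / real N \<le> (s\<^sup>2)\<^sup>2 * (K * (C\<^sup>2 / s) ^ 3) / s\<^sup>2"
        unfolding s(2)
        using card_pairs_le[of N] K s(1)
        by (intro divide_right_mono mult_right_mono) (auto simp flip: of_nat_power)
      also have "\<dots> = K * C ^ 6 / s"
        using s(1) by (simp add: field_simps eval_nat_numeral)
      finally show ?case by (simp add: s_def)
    qed
    then show ?thesis by blast
  qed
  \<comment> \<open>The whole space has mass 1 and log-mass 0, so the first claim is an instance of
    the second.\<close>
  have "F_zero P0 PX whole_space = (\<lambda>_. 0)"
    using F_zero_whole_space[OF P0(1) PX(1,2)] by auto
  then have "liminf (F_zero P0 PX whole_space) > -\<infinity>"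
    by (simp add: Liminf_const)
  with main whole_space_measurable show ?thesis by blast
qed

end
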